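(* Let $R$ be a local ring and let $G$ be a group such that the unit group ${\rm U}(RG)$ of the group ring $RG$ is a locally nilpotent group. If $RG$ is semi-nil clean, then $R$ is periodic and $G$ is locally finite.
   Context: Rings are associative with identity, not necessarily commutative; a ring is local if it has a unique maximal left ideal. An element $x$ of a ring is periodic if there exist two different positive integers $m\neq n$ with $x^m=x^n$; a ring is periodic if all its elements are periodic. A ring is semi-nil clean if each of its elements is the sum of a periodic element and a nilpotent element (no commutation required). A group is locally nilpotent (resp. locally finite) if each of its finitely generated subgroups is nilpotent (resp. finite). *)

theory Defs
  imports "HOL-Algebra.Algebra"
begin

definition left_ideal :: "'a set \<Rightarrow> ('a, 'm) ring_scheme \<Rightarrow> bool" where
  "left_ideal I R \<longleftrightarrow>
     additive_subgroup I R \<and> (\<forall>r \<in> carrier R. \<forall>a \<in> I. r \<otimes>\<^bsub>R\<^esub> a \<in> I)"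

definition maximal_left_ideal :: "'a set \<Rightarrow> ('a, 'm) ring_scheme \<Rightarrow> bool" where
  "maximal_left_ideal M R \<longleftrightarrow>
     left_ideal M R \<and> M \<noteq> carrier R \<and>
     (\<forall>J. left_ideal J R \<and> M \<subseteq> J \<longrightarrow> J = M \<or> J = carrier R)"

definition local_ring :: "('a, 'm) ring_scheme \<Rightarrow> bool" where
  "local_ring R \<longleftrightarrow> ring R \<and> (\<exists>!M. maximal_left_ideal M R)"

definition periodic_elem :: "('a, 'm) ring_scheme \<Rightarrow> 'a \<Rightarrow> bool" where
  "periodic_elem R x \<longleftrightarrow>
     (\<exists>m n :: nat. 0 < m \<and> 0 < n \<and> m \<noteq> n \<and> x [^]\<^bsub>R\<^esub> m = x [^]\<^bsub>R\<^esub> n)"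

definition periodic_ring :: "('a, 'm) ring_scheme \<Rightarrow> bool" where
  "periodic_ring R \<longleftrightarrow> (\<forall>x \<in> carrier R. periodic_elem R x)"

definition nilpotent_elem :: "('a, 'm) ring_scheme \<Rightarrow> 'a \<Rightarrow> bool" where
  "nilpotent_elem R x \<longleftrightarrow> (\<exists>n :: nat. 0 < n \<and> x [^]\<^bsub>R\<^esub> n = \<zero>\<^bsub>R\<^esub>)"

definition semi_nil_clean :: "('a, 'm) ring_scheme \<Rightarrow> bool" where
  "semi_nil_clean R \<longleftrightarrow>
     (\<forall>x \<in> carrier R. \<exists>p \<in> carrier R. \<exists>q \<in> carrier R.
        periodic_elem R p \<and> nilpotent_elem R q \<and> x = p \<oplus>\<^bsub>R\<^esub> q)"

definition commutator_subgroup :: "('a, 'm) monoid_scheme \<Rightarrow> 'a set \<Rightarrow> 'a set \<Rightarrow> 'a set" where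
  "commutator_subgroup G H K =
     generate G (\<Union>h \<in> H. \<Union>k \<in> K. {h \<otimes>\<^bsub>G\<^esub> k \<otimes>\<^bsub>G\<^esub> inv\<^bsub>G\<^esub> h \<otimes>\<^bsub>G\<^esub> inv\<^bsub>G\<^esub> k})"

primrec lower_central_series :: "('a, 'm) monoid_scheme \<Rightarrow> nat \<Rightarrow> 'a set" where
  "lower_central_series G 0 = carrier G"
| "lower_central_series G (Suc n) =
     commutator_subgroup G (lower_central_series G n) (carrier G)"

definition nilpotent_group :: "('a, 'm) monoid_scheme \<Rightarrow> bool" where
  "nilpotent_group G \<longleftrightarrow> (\<exists>n. lower_central_series G n = {\<one>\<^bsub>G\<^esub>})"

definition locally_nilpotent :: "('a, 'm) monoid_scheme \<Rightarrow> bool" where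
  "locally_nilpotent G \<longleftrightarrow>
     (\<forall>A. finite A \<and> A \<subseteq> carrier G \<longrightarrow> nilpotent_group (subgroup_generated G A))"

definition locally_finite :: "('a, 'm) monoid_scheme \<Rightarrow> bool" where
  "locally_finite G \<longleftrightarrow>
     (\<forall>A. finite A \<and> A \<subseteq> carrier G \<longrightarrow> finite (carrier (subgroup_generated G A)))"

definition coeff_support :: "('r, 'm) ring_scheme \<Rightarrow> ('g \<Rightarrow> 'r) \<Rightarrow> 'g set" where
  "coeff_support R f = {g. f g \<noteq> \<zero>\<^bsub>R\<^esub>}"

text \<open>
  An element \<open>\<Sum> r\<^sub>g g\<close> of the group ring is encoded by its coefficient function
  \<open>g \<mapsto> r\<^sub>g\<close>. Coefficient functions are \<open>\<zero>\<close> (not \<open>undefined\<close>) outside the carrier of the group,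
  so that equality in the group ring is equality of functions.
\<close>

definition group_ring :: "('r, 'm) ring_scheme \<Rightarrow> ('g, 'n) monoid_scheme \<Rightarrow> ('g \<Rightarrow> 'r) ring" where
  "group_ring R G =
     \<lparr>carrier = {f. range f \<subseteq> carrier R \<and> finite (coeff_support R f) \<and>
                    coeff_support R f \<subseteq> carrier G},
      monoid.mult = (\<lambda>f h x. finsum R (\<lambda>(u, v). f u \<otimes>\<^bsub>R\<^esub> h v)
                {(u, v). u \<in> coeff_support R f \<and> v \<in> coeff_support R h \<and> u \<otimes>\<^bsub>G\<^esub> v = x}),
      one = (\<lambda>x. if x = \<one>\<^bsub>G\<^esub> then \<one>\<^bsub>R\<^esub> else \<zero>\<^bsub>R\<^esub>),
      ring.zero = (\<lambda>x. \<zero>\<^bsub>R\<^esub>),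
      add = (\<lambda>f h x. f x \<oplus>\<^bsub>R\<^esub> h x)\<rparr>"

end

theory Submission
  imports Defs
begin

text \<open>
  Every unit \<open>g\<close> of a semi-nil clean ring \<open>S\<close> with locally nilpotent unit group has finite order.
  Writing \<open>2 = p + q\<close> with \<open>p\<close> periodic and \<open>q\<close> nilpotent shows that \<open>S\<close> has positive
  characteristic, so finite subsets of \<open>S\<close> have finite additive span. Now write \<open>g = p + q\<close>.
  The unit \<open>v = 1 - q\<close> has finite order, and local nilpotency provides a finite group \<open>W\<close> of units
  with \<open>v \<in> W\<close> and \<open>g W g\<^sup>-\<^sup>1 \<subseteq> W\<close>. Since \<open>p = g + v - 1\<close>, an equation \<open>p\<^sup>m = p\<^sup>n\<close> with \<open>m < n\<close>
  makes \<open>g\<^sup>n\<close> a combination of the \<open>w g\<^sup>i\<close> with \<open>w \<in> W\<close> and \<open>i < n\<close>, so all powers of \<open>g\<close> lie in a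
  finite set.

  For \<open>S = RG\<close>, both \<open>G\<close> and the units of \<open>R\<close> embed in the units of \<open>RG\<close>; finitely generated
  nilpotent groups with torsion generators are finite, and in the local ring \<open>R\<close> every \<open>x\<close> has
  \<open>x\<close> or \<open>1 - x\<close> invertible.
\<close>

subsection \<open>Finitely generated nilpotent groups\<close>

context group
begin

definition word_prod :: "'a list \<Rightarrow> 'a" where
  "word_prod w = foldr (\<otimes>) w \<one>"

lemma word_prod_simps [simp]:
  "word_prod [] = \<one>" "word_prod (x # w) = x \<otimes> word_prod w"
  by (simp_all add: word_prod_def)

lemma word_prod_closed [simp]: "set w \<subseteq> carrier G \<Longrightarrow> word_prod w \<in> carrier G"
  by (induction w) auto

lemma word_prod_append:
  "set v \<subseteq> carrier G \<Longrightarrow> set w \<subseteq> carrier G \<Longrightarrow> word_prod (v @ w) = word_prod v \<otimes> word_prod w"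
  by (induction v) (auto simp: m_assoc)

lemma word_prod_replicate: "x \<in> carrier G \<Longrightarrow> word_prod (replicate n x) = x [^] n"
  by (induction n) (auto simp: nat_pow_Suc2 simp del: nat_pow_Suc Group.nat_pow_Suc)

text \<open>Moving \<open>x\<close> to the left past a letter only conjugates that letter, which
  therefore stays in \<open>B\<close>. All occurrences of \<open>x\<close> can thus be gathered in
  front without changing the length.\<close>

lemma word_prod_collect:
  assumes B: "B \<subseteq> carrier G" and conj: "\<And>b g. b \<in> B \<Longrightarrow> g \<in> carrier G \<Longrightarrow> g \<otimes> b \<otimes> inv g \<in> B"
    and x: "x \<in> B" and w: "set w \<subseteq> B"
  shows "\<exists>w'. set w' \<subseteq> B \<and> length w' + count_list w x = length w
             \<and> word_prod w = x [^] count_list w x \<otimes> word_prod w'"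
  using w
proof (induction w)
  case Nil
  then show ?case by auto
next
  case (Cons b w)
  have xG: "x \<in> carrier G" and bG: "b \<in> carrier G" using x B Cons.prems by auto
  obtain w' where w': "set w' \<subseteq> B" "length w' + count_list w x = length w"
      "word_prod w = x [^] count_list w x \<otimes> word_prod w'"
    using Cons by auto
  have w'G: "word_prod w' \<in> carrier G" using w'(1) B by auto
  show ?case
  proof (cases "b = x")
    case True
    have "word_prod (b # w) = x [^] count_list (b # w) x \<otimes> word_prod w'"
      using True w'(3) w'G xG by (simp add: m_assoc nat_pow_Suc2 del: nat_pow_Suc Group.nat_pow_Suc)
    then show ?thesis using w' True by auto
  next
    case False
    define k where "k = count_list w x"
    \<comment> \<open>\<open>c\<close> is \<open>b\<close> conjugated by the inverse of
      \<open>x [^] k\<close>; the double inverse gives it the shape that \<open>conj\<close>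
      expects.\<close>
    define c where "c = inv (x [^] k) \<otimes> b \<otimes> inv (inv (x [^] k))"
    have c: "c \<in> B" unfolding c_def using Cons.prems xG by (intro conj) auto
    have "b \<otimes> x [^] k = x [^] k \<otimes> c"
      unfolding c_def using xG bG by (simp add: m_assoc[symmetric])
    moreover have "c \<in> carrier G" using c B by auto
    ultimately have "word_prod (b # w) = x [^] k \<otimes> word_prod (c # w')"
      using w'(3) w'G xG bG by (simp add: m_assoc[symmetric] k_def[symmetric])
    then show ?thesis using w' c False k_def
      by (intro exI[of _ "c # w'"]) auto
  qed
qed

text \<open>The product of the individual exponents is a multiple of each of them.\<close>

lemma common_exponent:
  assumes "finite B" "B \<subseteq> carrier G" "\<And>b. b \<in> B \<Longrightarrow> \<exists>n>0. b [^] (n::nat) = \<one>"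
  shows "\<exists>m>0. \<forall>b\<in>B. b [^] (m::nat) = \<one>"
proof -
  obtain n :: "'a \<Rightarrow> nat" where n: "\<And>b. b \<in> B \<Longrightarrow> n b > 0 \<and> b [^] n b = \<one>"
    using assms(3) by metis
  have "b [^] prod n B = \<one>" if b: "b \<in> B" for b
  proof -
    obtain j where j: "prod n B = n b * j"
      using b assms(1) dvd_prodI[of B b n] by (auto elim: dvdE)
    have "b \<in> carrier G" using b assms(2) by auto
    then show ?thesis using n[OF b] unfolding j by (simp add: nat_pow_pow[symmetric])
  qed
  moreover have "prod n B > 0" using n by (intro prod_pos) auto
  ultimately show ?thesis by blast
qed

text \<open>By pigeonhole, a word longer than \<open>card B * m\<close>, with \<open>m\<close> a
  common exponent, contains some letter at least \<open>m\<close> times. Collecting that letter and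
  deleting \<open>m\<close> copies of it shortens the word, so words of bounded length already give
  every element.\<close>

theorem dietzmann:
  assumes fin: "finite B" and B: "B \<subseteq> carrier G"
    and conj: "\<And>b g. b \<in> B \<Longrightarrow> g \<in> carrier G \<Longrightarrow> g \<otimes> b \<otimes> inv g \<in> B"
    and tors: "\<And>b. b \<in> B \<Longrightarrow> \<exists>n>0. b [^] (n::nat) = \<one>"
  shows "finite (generate G B)"
proof -
  obtain m :: nat where m: "m > 0" "\<And>b. b \<in> B \<Longrightarrow> b [^] m = \<one>"
    using common_exponent[OF fin B tors] by blast
  have short: "\<exists>w'. set w' \<subseteq> B \<and> length w' \<le> card B * m \<and> word_prod w = word_prod w'"
    if "set w \<subseteq> B" for w
    using that
  proof (induction "length w" arbitrary: w rule: less_induct)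
    case less
    show ?case
    proof (cases "length w \<le> card B * m")
      case True
      then show ?thesis using less.prems by blast
    next
      case False
      have "\<exists>x\<in>B. count_list w x \<ge> m"
      proof (rule ccontr)
        assume "\<not> ?thesis"
        then have "sum (count_list w) B \<le> card B * m"
          using sum_bounded_above[of B "count_list w" m] by (auto simp: not_le less_imp_le)
        then show False using False sum_count_set[OF less.prems fin] by simp
      qed
      then obtain x where x: "x \<in> B" "count_list w x \<ge> m" by blast
      have xG: "x \<in> carrier G" using x B by auto
      obtain w' where w': "set w' \<subseteq> B" "length w' + count_list w x = length w"
          "word_prod w = x [^] count_list w x \<otimes> word_prod w'"
        using word_prod_collect[OF B conj x(1) less.prems] by blast
      \<comment> \<open>\<open>v\<close> is the collected word without \<open>m\<close> copies of
        \<open>x\<close>, whose product is \<open>\<one>\<close>.\<close>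
      define v where "v = replicate (count_list w x - m) x @ w'"
      have "x [^] count_list w x = x [^] (count_list w x - m) \<otimes> x [^] m"
        using x xG by (simp add: nat_pow_mult)
      then have "x [^] count_list w x = x [^] (count_list w x - m)"
        using m(2) x xG by simp
      moreover have "word_prod v = x [^] (count_list w x - m) \<otimes> word_prod w'"
        unfolding v_def using w'(1) B xG
        by (subst word_prod_append) (auto simp: word_prod_replicate)
      ultimately have "word_prod v = word_prod w" using w'(3) by simp
      moreover have "length v < length w" "set v \<subseteq> B"
        using w' x m(1) by (auto simp: v_def)
      ultimately show ?thesis using less.hyps by metis
    qed
  qed
  have "\<exists>w. set w \<subseteq> B \<and> y = word_prod w" if "y \<in> generate G B" for y
    using that
  proof (induction rule: generate.induct)
    case one
    then show ?case by (intro exI[of _ "[]"]) auto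
  next
    case (incl h)
    then show ?case using B by (intro exI[of _ "[h]"]) auto
  next
    case (inv h)
    have hG: "h \<in> carrier G" using inv B by auto
    \<comment> \<open>Torsion turns inverses into positive powers, so words without inverse letters
      suffice.\<close>
    have "h [^] (m - 1) \<otimes> h = \<one>"
      using m(1) m(2)[OF inv] nat_pow_Suc[of h "m - 1"] by simp
    then have "inv h = h [^] (m - 1)" using hG by (intro inv_equality) auto
    then show ?case using inv hG
      by (intro exI[of _ "replicate (m - 1) h"]) (auto simp: word_prod_replicate)
  next
    case (eng h1 h2)
    then obtain w1 w2 where "set w1 \<subseteq> B" "h1 = word_prod w1" "set w2 \<subseteq> B" "h2 = word_prod w2"
      by blast
    then show ?case using B by (intro exI[of _ "w1 @ w2"]) (auto simp: word_prod_append)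
  qed
  then have "generate G B \<subseteq> word_prod ` {w. set w \<subseteq> B \<and> length w \<le> card B * m}"
    using short by blast
  then show ?thesis using finite_lists_length_le[OF fin] finite_subset by blast
qed

end

section \<open>Torsion and the lower central series\<close>

lemma (in group) conj_nat_pow:
  assumes "g \<in> carrier G" "x \<in> carrier G"
  shows "(g \<otimes> x \<otimes> inv g) [^] (n::nat) = g \<otimes> x [^] n \<otimes> inv g"
proof (induction n)
  case (Suc n)
  have "inv g \<otimes> (g \<otimes> z) = z" if "z \<in> carrier G" for z
    using assms that by (simp add: m_assoc[symmetric])
  then show ?case using Suc assms by (simp add: m_assoc)
qed (use assms in simp)

text \<open>Conjugation is a homomorphism, so it maps commutators to commutators, and by induction
  it preserves the preceding term. The generating set of each term is therefore invariant under
  conjugation.\<close>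

lemma (in group) lower_central_series_normal: "lower_central_series G k \<lhd> G"
proof (induction k)
  case 0
  then show ?case by (simp add: normal_inv_iff subgroup_self)
next
  case (Suc k)
  let ?N = "lower_central_series G k"
  interpret N: normal ?N G by (rule Suc)
  show ?case
    unfolding lower_central_series.simps commutator_subgroup_def
  proof (rule normal_generateI)
    show "(\<Union>h\<in>?N. \<Union>x\<in>carrier G. {h \<otimes> x \<otimes> inv h \<otimes> inv x}) \<subseteq> carrier G"
      using N.subset by auto
    fix y g assume "y \<in> (\<Union>h\<in>?N. \<Union>x\<in>carrier G. {h \<otimes> x \<otimes> inv h \<otimes> inv x})" and g: "g \<in> carrier G"
    then obtain h x where h: "h \<in> ?N" and x: "x \<in> carrier G" and y: "y = h \<otimes> x \<otimes> inv h \<otimes> inv x"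
      by blast
    have hG: "h \<in> carrier G" using h N.subset by auto
    have cancel: "inv g \<otimes> (g \<otimes> z) = z" if "z \<in> carrier G" for z
      using g that by (simp add: m_assoc[symmetric])
    have "g \<otimes> y \<otimes> inv g =
        (g \<otimes> h \<otimes> inv g) \<otimes> (g \<otimes> x \<otimes> inv g) \<otimes> inv (g \<otimes> h \<otimes> inv g) \<otimes> inv (g \<otimes> x \<otimes> inv g)"
      unfolding y using g hG x by (simp add: inv_mult_group m_assoc cancel)
    moreover have "g \<otimes> h \<otimes> inv g \<in> ?N" using N.inv_op_closed2[OF g h] .
    moreover have "g \<otimes> x \<otimes> inv g \<in> carrier G" using g x by simp
    ultimately show "g \<otimes> y \<otimes> inv g \<in> (\<Union>h\<in>?N. \<Union>x\<in>carrier G. {h \<otimes> x \<otimes> inv h \<otimes> inv x})"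
      by blast
  qed
qed

lemma (in group) commutator_in_lower_central_series_Suc:
  assumes "h \<in> lower_central_series G k" "x \<in> carrier G"
  shows "h \<otimes> x \<otimes> inv h \<otimes> inv x \<in> lower_central_series G (Suc k)"
  unfolding lower_central_series.simps commutator_subgroup_def
  using assms by (intro generate.incl) blast

text \<open>
  Modulo the next term of the series, the conjugate \<open>h a h\<^sup>-\<^sup>1\<close> only depends on the coset of \<open>h\<close> modulo
  the current term, so the generators have finitely many conjugates and Dietzmann's lemma applies.
\<close>

lemma (in group) finite_lower_central_quotient:
  assumes A: "finite A" "A \<subseteq> carrier G" and gen: "generate G A = carrier G"
    and tors: "\<And>a. a \<in> A \<Longrightarrow> \<exists>n>0. a [^] (n::nat) = \<one>"
  shows "finite (carrier (G Mod lower_central_series G k))"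
proof (induction k)
  case 0
  have "carrier (G Mod carrier G) \<subseteq> {carrier G}"
    by (auto simp: FactGroup_def RCOSETS_def coset_join2 subgroup_self)
  then show ?case using finite_subset by auto
next
  case (Suc k)
  let ?N = "lower_central_series G k" and ?M = "lower_central_series G (Suc k)"
  interpret N: normal ?N G by (rule lower_central_series_normal)
  interpret M: normal ?M G by (rule lower_central_series_normal)
  interpret Q: group "G Mod ?M" by (rule M.factorgroup_is_group)
  interpret \<pi>: group_hom G "G Mod ?M" "\<lambda>a. ?M #> a"
    by (intro group_hom.intro group_hom_axioms.intro M.r_coset_hom_Mod is_group Q.is_group)
  have carQ: "carrier (G Mod ?M) = (\<lambda>a. ?M #> a) ` carrier G"
    by (auto simp: FactGroup_def RCOSETS_def)
  \<comment> \<open>\<open>F\<close> is a finite set of representatives of the cosets of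
    \<open>?N\<close>, available by the induction hypothesis.\<close>
  obtain F where F: "finite F" "F \<subseteq> carrier G" "rcosets ?N = (\<lambda>a. ?N #> a) ` F"
  proof -
    have "finite (rcosets ?N)" using Suc by (simp add: FactGroup_def)
    moreover have "rcosets ?N = (\<lambda>a. ?N #> a) ` carrier G" by (auto simp: RCOSETS_def)
    ultimately show ?thesis using that finite_subset_image[of "rcosets ?N" "\<lambda>a. ?N #> a" "carrier G"]
      by auto
  qed
  define B where "B = (\<lambda>a. ?M #> a) ` (\<lambda>(f, a). f \<otimes> a \<otimes> inv f) ` (F \<times> A)"
  have conjB: "?M #> (h \<otimes> a \<otimes> inv h) \<in> B" if h: "h \<in> carrier G" and a: "a \<in> A" for h a
  proof -
    have aG: "a \<in> carrier G" using a A by auto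
    have "?N #> h \<in> rcosets ?N" using h by (auto simp: RCOSETS_def)
    then obtain f where f: "f \<in> F" "?N #> h = ?N #> f" using F(3) by auto
    have fG: "f \<in> carrier G" using f F by auto
    have "h \<in> ?N #> f" using f(2) rcos_self[OF h N.subgroup_axioms] by simp
    then obtain n where n: "n \<in> ?N" "h = n \<otimes> f" by (auto simp: r_coset_def)
    have nG: "n \<in> carrier G" using n N.subset by auto
    define y where "y = f \<otimes> a \<otimes> inv f"
    have yG: "y \<in> carrier G" unfolding y_def using fG aG by simp
    \<comment> \<open>With \<open>h = n \<otimes> f\<close>, the conjugate of \<open>a\<close> by
      \<open>h\<close> is that of \<open>y\<close> by \<open>n\<close>, and hence \<open>y\<close>
      times a commutator that lies in \<open>?M\<close>.\<close>
    have "h \<otimes> a \<otimes> inv h = (n \<otimes> y \<otimes> inv n \<otimes> inv y) \<otimes> y"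
    proof -
      have "h \<otimes> a \<otimes> inv h = n \<otimes> y \<otimes> inv n"
        unfolding n(2) y_def using nG fG aG by (simp add: inv_mult_group m_assoc)
      then show ?thesis using nG yG by (simp add: m_assoc)
    qed
    then have "h \<otimes> a \<otimes> inv h \<in> ?M #> y"
      using commutator_in_lower_central_series_Suc[OF n(1) yG] unfolding r_coset_def by blast
    then have "?M #> (h \<otimes> a \<otimes> inv h) = ?M #> y"
      using repr_independence[OF _ yG M.is_subgroup] by simp
    then show ?thesis unfolding B_def y_def using f(1) a by auto
  qed
  have AB: "(\<lambda>a. ?M #> a) ` A \<subseteq> B"
    using conjB[of \<one>] A by (auto simp: subset_iff)
  have BQ: "B \<subseteq> carrier (G Mod ?M)"
    unfolding B_def carQ using subsetD[OF F(2)] subsetD[OF A(2)] by auto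
  have "carrier (G Mod ?M) = generate (G Mod ?M) ((\<lambda>a. ?M #> a) ` A)"
    using \<pi>.generate_img[OF A(2)] gen carQ by simp
  then have "carrier (G Mod ?M) \<subseteq> generate (G Mod ?M) B"
    using Q.mono_generate[OF AB] by simp
  moreover have "finite (generate (G Mod ?M) B)"
  proof (rule Q.dietzmann[OF _ BQ])
    show "finite B" unfolding B_def using F A by simp
  next
    fix b g assume b: "b \<in> B" and g: "g \<in> carrier (G Mod ?M)"
    obtain f a where fa: "f \<in> F" "a \<in> A" "b = ?M #> (f \<otimes> a \<otimes> inv f)"
      using b by (auto simp: B_def)
    obtain h where h: "h \<in> carrier G" "g = ?M #> h" using g carQ by auto
    have G: "f \<in> carrier G" "a \<in> carrier G" using fa F A by auto
    have "g \<otimes>\<^bsub>G Mod ?M\<^esub> b \<otimes>\<^bsub>G Mod ?M\<^esub> inv\<^bsub>G Mod ?M\<^esub> g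
        = ?M #> (h \<otimes> (f \<otimes> a \<otimes> inv f) \<otimes> inv h)"
      unfolding h(2) fa(3) using h(1) G by (simp only: \<pi>.hom_inv[symmetric] \<pi>.hom_mult[symmetric] m_closed inv_closed)
    also have "h \<otimes> (f \<otimes> a \<otimes> inv f) \<otimes> inv h = (h \<otimes> f) \<otimes> a \<otimes> inv (h \<otimes> f)"
      using h(1) G by (simp add: inv_mult_group m_assoc)
    also have "?M #> \<dots> \<in> B" using conjB[of "h \<otimes> f" a] h(1) G fa by simp
    finally show "g \<otimes>\<^bsub>G Mod ?M\<^esub> b \<otimes>\<^bsub>G Mod ?M\<^esub> inv\<^bsub>G Mod ?M\<^esub> g \<in> B" .
  next
    fix b assume "b \<in> B"
    then obtain f a where fa: "f \<in> F" "a \<in> A" "b = ?M #> (f \<otimes> a \<otimes> inv f)"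
      by (auto simp: B_def)
    have G: "f \<in> carrier G" "a \<in> carrier G" using fa F A by auto
    obtain n :: nat where n: "n > 0" "a [^] n = \<one>" using tors fa by blast
    have "(f \<otimes> a \<otimes> inv f) [^] n = \<one>" using n G by (simp add: conj_nat_pow)
    then have "b [^]\<^bsub>G Mod ?M\<^esub> n = ?M #> \<one>"
      using \<pi>.hom_nat_pow[of "f \<otimes> a \<otimes> inv f" n] G fa(3) by simp
    then have "b [^]\<^bsub>G Mod ?M\<^esub> n = \<one>\<^bsub>G Mod ?M\<^esub>"
      using \<pi>.hom_one by metis
    then show "\<exists>n>0. b [^]\<^bsub>G Mod ?M\<^esub> (n::nat) = \<one>\<^bsub>G Mod ?M\<^esub>" using n by blast
  qed
  ultimately show ?case using finite_subset by blast
qed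

text \<open>The quotient by the trivial term of the series is finite, and it is a copy of the group
  itself.\<close>

lemma (in group) finite_if_nilpotent_torsion_generated:
  assumes A: "finite A" "A \<subseteq> carrier G" and gen: "generate G A = carrier G"
    and tors: "\<And>a. a \<in> A \<Longrightarrow> \<exists>n>0. a [^] (n::nat) = \<one>"
    and nil: "nilpotent_group G"
  shows "finite (carrier G)"
proof -
  obtain k where k: "lower_central_series G k = {\<one>}"
    using nil by (auto simp: nilpotent_group_def)
  have "finite ((\<lambda>a. {\<one>} #> a) ` carrier G)"
    using finite_lower_central_quotient[OF A gen tors, of k] unfolding k
    by (simp add: FactGroup_def RCOSETS_def UNION_singleton_eq_range)
  moreover have "inj_on (\<lambda>a. {\<one>} #> a) (carrier G)"
    by (auto simp: inj_on_def r_coset_def)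
  ultimately show ?thesis using finite_imageD by blast
qed

lemma (in group) finite_generate_if_locally_nilpotent:
  assumes ln: "locally_nilpotent G" and A: "finite A" "A \<subseteq> carrier G"
    and tors: "\<And>a. a \<in> A \<Longrightarrow> \<exists>n>0. a [^] (n::nat) = \<one>"
  shows "finite (generate G A)"
proof -
  let ?H = "subgroup_generated G A"
  interpret H: group ?H by simp
  have car: "carrier ?H = generate G A"
    using A by (simp add: carrier_subgroup_generated Int_absorb1)
  have AH: "A \<subseteq> carrier ?H" using A by (simp add: subgroup_generated_subset_carrier_subset)
  have "finite (carrier ?H)"
  proof (rule H.finite_if_nilpotent_torsion_generated[OF A(1) AH])
    have "carrier (subgroup_generated ?H A) = generate ?H A"
      using AH by (simp only: carrier_subgroup_generated Int_absorb1)
    then show "generate ?H A = carrier ?H" by simp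
    show "nilpotent_group ?H" using ln A by (auto simp: locally_nilpotent_def)
    show "\<exists>n>0. a [^]\<^bsub>?H\<^esub> (n::nat) = \<one>\<^bsub>?H\<^esub>" if "a \<in> A" for a
      using tors[OF that] by (simp add: pow_subgroup_generated)
  qed
  then show ?thesis using car by simp
qed

text \<open>
  The iterated commutator of \<open>v\<close> with \<open>g\<close> (\<open>c\<close> times) is trivial, and it involves the conjugate
  of \<open>v\<close> under \<open>g\<^sup>c\<close> exactly once.
\<close>

lemma (in group) conj_pow_in_generate_if_nilpotent:
  assumes nil: "nilpotent_group (subgroup_generated G {g, v})"
    and g: "g \<in> carrier G" and v: "v \<in> carrier G"
  shows "\<exists>c::nat. g [^] c \<otimes> v \<otimes> inv (g [^] c)
           \<in> generate G ((\<lambda>i::nat. g [^] i \<otimes> v \<otimes> inv (g [^] i)) ` {..<c})"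
proof -
  define u where "u = (\<lambda>i::nat. g [^] i \<otimes> v \<otimes> inv (g [^] i))"
  \<comment> \<open>\<open>K c\<close> is generated by the conjugates of index below
    \<open>c\<close>; the goal is \<open>u c \<in> K c\<close> for some \<open>c\<close>.\<close>
  define K where "K = (\<lambda>c::nat. generate G (u ` {..<c}))"
  define cj where "cj = (\<lambda>x. g \<otimes> x \<otimes> inv g)"
  \<comment> \<open>\<open>a (Suc k)\<close> is the commutator of \<open>inv (a k)\<close> with
    \<open>g\<close>, in the convention of \<open>commutator_subgroup\<close>, so that
    \<open>a\<close> descends the lower central series.\<close>
  define a where "a = rec_nat v (\<lambda>_ x. inv x \<otimes> cj x)"
  have a0: "a 0 = v" and aS: "a (Suc k) = inv (a k) \<otimes> cj (a k)" for k
    by (simp_all add: a_def)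
  have uG: "u i \<in> carrier G" for i using g v by (simp add: u_def)
  have KG: "K c \<subseteq> carrier G" for c unfolding K_def using uG by (intro generate_incl) auto
  have Ksub: "subgroup (K c) G" for c unfolding K_def using uG by (intro generate_is_subgroup) auto
  have Kmono: "K c \<subseteq> K (Suc c)" for c unfolding K_def by (intro mono_generate) auto
  have uK: "u i \<in> K (Suc i)" for i unfolding K_def by (intro generate.incl) auto
  have cju: "cj (u i) = u (Suc i)" for i
    unfolding cj_def u_def using g v
    by (simp add: nat_pow_Suc2 inv_mult_group m_assoc del: nat_pow_Suc Group.nat_pow_Suc)
  have cj_mult: "cj (x \<otimes> y) = cj x \<otimes> cj y" if "x \<in> carrier G" "y \<in> carrier G" for x y
    unfolding cj_def using g that by (simp add: m_assoc inv_solve_left)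
  have cj_inv: "cj (inv x) = inv (cj x)" if "x \<in> carrier G" for x
    unfolding cj_def using g that by (simp add: m_assoc inv_mult_group)
  have cjK: "cj x \<in> K (Suc c)" if "x \<in> K c" for x c
    using that unfolding K_def
  proof (induction rule: generate.induct)
    case one
    then show ?case using g by (simp add: cj_def generate.one)
  next
    case (incl h)
    then show ?case by (auto simp: cju intro!: generate.incl)
  next
    case (inv h)
    then obtain i where i: "i < c" "h = u i" by auto
    then show ?case using cj_inv[OF uG] cju by (auto intro!: generate.inv)
  next
    case (eng h1 h2)
    then have "h1 \<in> carrier G" "h2 \<in> carrier G" using KG[of c] by (auto simp: K_def)
    then show ?case using eng by (simp add: cj_mult generate.eng)
  qed
  \<comment> \<open>The invariant isolates a single occurrence of \<open>u k\<close>. In the next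
    step \<open>inv (a k)\<close> involves only indices up to \<open>k\<close> and is absorbed on
    the left, while conjugation by \<open>g\<close> turns \<open>u k\<close> into
    \<open>u (Suc k)\<close>.\<close>
  have form: "\<exists>w\<in>K k. \<exists>w'\<in>K k. a k = w \<otimes> u k \<otimes> w'" for k
  proof (induction k)
    case 0
    have "\<one> \<in> K 0" by (simp add: K_def generate.one)
    then show ?case using v a0 by (intro bexI[of _ \<one>]) (auto simp: u_def)
  next
    case (Suc k)
    then obtain w w' where w: "w \<in> K k" "w' \<in> K k" "a k = w \<otimes> u k \<otimes> w'" by blast
    have G: "w \<in> carrier G" "w' \<in> carrier G" using w KG by auto
    have "a k \<in> K (Suc k)"
      using w Kmono uK Ksub[of "Suc k"] by (auto intro!: subgroup.m_closed)
    then have "inv (a k) \<otimes> cj w \<in> K (Suc k)"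
      using Ksub cjK[OF w(1)] by (auto intro!: subgroup.m_closed subgroup.m_inv_closed)
    moreover have "a (Suc k) = (inv (a k) \<otimes> cj w) \<otimes> u (Suc k) \<otimes> cj w'"
    proof -
      have "a k \<in> carrier G" "cj w \<in> carrier G" "cj w' \<in> carrier G"
        using w G uG cjK KG by (auto simp: cj_def g)
      then show ?thesis unfolding aS using w(3) G uG by (simp add: cj_mult cju m_assoc)
    qed
    ultimately show ?case using cjK[OF w(2)] by blast
  qed
  let ?H = "subgroup_generated G {g, v}"
  interpret H: group ?H by simp
  have gvH: "g \<in> carrier ?H" "v \<in> carrier ?H"
    using g v by (auto simp: carrier_subgroup_generated generate.incl)
  have HG: "carrier ?H \<subseteq> carrier G" by (rule carrier_subgroup_generated_subset)
  have aL: "a k \<in> lower_central_series ?H k" for k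
  proof (induction k)
    case 0
    then show ?case using gvH a0 by simp
  next
    case (Suc k)
    interpret N: normal "lower_central_series ?H k" ?H by (rule H.lower_central_series_normal)
    have aH: "a k \<in> carrier ?H" using Suc N.subset by auto
    have iH: "inv (a k) \<in> carrier ?H" using H.inv_closed[OF aH] aH by simp
    have "inv\<^bsub>?H\<^esub> (a k) \<in> lower_central_series ?H k" using Suc by (rule N.m_inv_closed)
    from H.commutator_in_lower_central_series_Suc[OF this gvH(1)]
    show ?case using aH gvH iH HG unfolding aS cj_def by (auto simp: m_assoc subset_iff g)
  qed
  obtain c where c: "lower_central_series ?H c = {\<one>}"
    using nil by (auto simp: nilpotent_group_def)
  have "a c = \<one>" using aL[of c] c by simp
  then obtain w w' where w: "w \<in> K c" "w' \<in> K c" "w \<otimes> u c \<otimes> w' = \<one>" using form[of c] by auto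
  have G: "w \<in> carrier G" "w' \<in> carrier G" using w KG by auto
  \<comment> \<open>At the class \<open>c\<close> the iterated commutator is trivial, so the
    isolated factor can be solved for.\<close>
  have "u c = inv w \<otimes> inv w'"
  proof -
    have "w \<otimes> u c = inv w'" using w(3) G uG by (metis inv_equality inv_inv m_closed)
    then show ?thesis using G uG by (metis inv_solve_left inv_closed)
  qed
  then have "u c \<in> K c" using w Ksub by (auto intro!: subgroup.m_closed subgroup.m_inv_closed)
  then show ?thesis unfolding u_def K_def by blast
qed

text \<open>Once the conjugate of \<open>v\<close> by \<open>g [^] c\<close> lies in the subgroup
  generated by the earlier ones, conjugation by \<open>g\<close> maps that subgroup into itself. It
  is finite, being generated by finitely many conjugates of the torsion element
  \<open>v\<close>.\<close>

lemma (in group) finite_conj_invariant_subgroup_if_locally_nilpotent: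
  assumes ln: "locally_nilpotent G" and g: "g \<in> carrier G" and v: "v \<in> carrier G"
    and tors: "n > 0" "v [^] (n::nat) = \<one>"
  shows "\<exists>W. subgroup W G \<and> finite W \<and> v \<in> W \<and> (\<forall>w\<in>W. g \<otimes> w \<otimes> inv g \<in> W)"
proof -
  define u where "u = (\<lambda>i::nat. g [^] i \<otimes> v \<otimes> inv (g [^] i))"
  have "nilpotent_group (subgroup_generated G {g, v})"
    using ln g v by (auto simp: locally_nilpotent_def)
  from conj_pow_in_generate_if_nilpotent[OF this g v]
  obtain c where c: "u c \<in> generate G (u ` {..<c})" by (auto simp: u_def)
  define W where "W = generate G (u ` {..<c})"
  have uG: "u i \<in> carrier G" for i using g v by (simp add: u_def)
  have sub: "subgroup W G" unfolding W_def using uG by (intro generate_is_subgroup) auto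
  then interpret W: subgroup W G .
  \<comment> \<open>The case \<open>i = c\<close> is the content of \<open>c\<close>. It keeps the
    shift from \<open>u i\<close> to \<open>u (Suc i)\<close> inside \<open>W\<close> when
    \<open>i = c - 1\<close>, and gives \<open>v \<in> W\<close> even when
    \<open>c = 0\<close>.\<close>
  have uW: "u i \<in> W" if "i \<le> c" for i
    using that c unfolding W_def by (cases "i = c") (auto intro: generate.incl)
  have fin: "finite W"
    unfolding W_def
  proof (rule finite_generate_if_locally_nilpotent[OF ln])
    show "u ` {..<c} \<subseteq> carrier G" using uG by auto
    fix a assume "a \<in> u ` {..<c}"
    then obtain i :: nat where "a = g [^] i \<otimes> v \<otimes> inv (g [^] i)" unfolding u_def by blast
    then have "a [^] n = \<one>" using conj_nat_pow[of "g [^] i" v n] g v tors(2) by simp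
    then show "\<exists>n>0. a [^] (n::nat) = \<one>" using tors(1) by blast
  qed simp
  have "g \<otimes> w \<otimes> inv g \<in> W" if "w \<in> W" for w
    using that unfolding W_def
  proof (induction rule: generate.induct)
    case one
    then show ?case using g by (simp add: generate.one)
  next
    case (incl h)
    then obtain i where i: "i < c" "h = u i" by auto
    have "g \<otimes> u i \<otimes> inv g = u (Suc i)"
      unfolding u_def using g v by (simp add: nat_pow_Suc2 inv_mult_group m_assoc del: nat_pow_Suc Group.nat_pow_Suc)
    then show ?case using i uW[of "Suc i"] by (simp add: W_def)
  next
    case (inv h)
    then obtain i where i: "i < c" "h = u i" by auto
    have "g \<otimes> inv (u i) \<otimes> inv g = inv (u (Suc i))"
      unfolding u_def using g v by (simp add: nat_pow_Suc2 inv_mult_group m_assoc del: nat_pow_Suc Group.nat_pow_Suc)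
    then show ?case using i W.m_inv_closed[OF uW[of "Suc i"]] by (simp add: W_def)
  next
    case (eng h1 h2)
    then have G: "h1 \<in> carrier G" "h2 \<in> carrier G" using W.subset by (auto simp: W_def)
    have "g \<otimes> (h1 \<otimes> h2) \<otimes> inv g = (g \<otimes> h1 \<otimes> inv g) \<otimes> (g \<otimes> h2 \<otimes> inv g)"
      using g G by (simp add: m_assoc inv_solve_left)
    then show ?case using generate.eng[OF eng(3,4)] by simp
  qed
  moreover have "v \<in> W" using uW[of 0] v by (simp add: u_def)
  ultimately show ?thesis using sub fin by blast
qed

subsection \<open>Semi-nil clean rings\<close>

text \<open>This notation makes \<open>[n] \<cdot> x\<close> for integer multiples ambiguous.\<close>

no_notation ideal_prod (infixl "\<cdot>\<index>" 80)

section \<open>Additive spans and periodic elements\<close>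

context ring
begin

text \<open>These are the integer combinations of \<open>B\<close>. Phrasing them through
  \<open>generate\<close> makes the results on groups, Dietzmann's lemma included, available for
  spans.\<close>

abbreviation int_span :: "'a set \<Rightarrow> 'a set" where
  "int_span B \<equiv> generate (add_monoid R) B"

lemma int_span_closed: "B \<subseteq> carrier R \<Longrightarrow> y \<in> int_span B \<Longrightarrow> y \<in> carrier R"
  using add.generate_in_carrier by simp

lemma int_span_add: "y \<in> int_span B \<Longrightarrow> z \<in> int_span B \<Longrightarrow> y \<oplus> z \<in> int_span B"
  using generate.eng[of y "add_monoid R" B z] by simp

lemma int_span_minus:
  "B \<subseteq> carrier R \<Longrightarrow> y \<in> int_span B \<Longrightarrow> z \<in> int_span B \<Longrightarrow> y \<ominus> z \<in> int_span B"
  using add.generate_m_inv_closed[of B z] by (simp add: minus_eq int_span_add)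

text \<open>Left multiplication by \<open>x\<close> is additive, so checking generators is enough.
  Source and target differ because multiplication by a unit \<open>g\<close> will raise the
  exponents in a spanning set by one.\<close>

lemma int_span_mult_left:
  assumes x: "x \<in> carrier R" and B: "B \<subseteq> carrier R" and Y: "Y \<subseteq> carrier R"
    and xB: "\<And>y. y \<in> B \<Longrightarrow> x \<otimes> y \<in> int_span Y" and z: "z \<in> int_span B"
  shows "x \<otimes> z \<in> int_span Y"
  using z
proof (induction rule: generate.induct)
  case one
  then show ?case using x generate.one[of "add_monoid R" Y] by simp
next
  case (incl h)
  then show ?case by (rule xB)
next
  case (inv h)
  have "h \<in> carrier R" using inv B by auto
  then have "x \<otimes> inv\<^bsub>add_monoid R\<^esub> h = \<ominus> (x \<otimes> h)"
    using x by (simp add: a_inv_def[symmetric] r_minus)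
  then show ?case using add.generate_m_inv_closed[OF Y xB[OF inv]] by simp
next
  case (eng h1 h2)
  then have "h1 \<in> carrier R" "h2 \<in> carrier R" using int_span_closed[OF B] by auto
  then show ?case using eng int_span_add x by (simp add: r_distr)
qed

lemma add_pow_eq_zero_if_char:
  assumes "[N] \<cdot> \<one> = \<zero>" "x \<in> carrier R"
  shows "[(N::nat)] \<cdot> x = \<zero>"
  using add_pow_ldistr[of \<one> x N] assms by simp

text \<open>Addition is commutative, so every set is invariant under additive conjugation, and
  positive characteristic makes each element additively torsion: Dietzmann's lemma applies.\<close>

lemma finite_int_span:
  assumes N: "N > 0" "[(N::nat)] \<cdot> \<one> = \<zero>" and B: "finite B" "B \<subseteq> carrier R"
  shows "finite (int_span B)"
proof (rule add.dietzmann)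
  fix b g assume b: "b \<in> B" and g: "g \<in> carrier R"
  have "b \<in> carrier R" using b B by auto
  then have "g \<oplus> b \<oplus> \<ominus> g = b" using g by algebra
  then show "g \<oplus> b \<oplus> \<ominus> g \<in> B" using b by simp
next
  fix b assume "b \<in> B"
  then have "[N] \<cdot> b = \<zero>" using N add_pow_eq_zero_if_char B by auto
  then show "\<exists>n>0. [(n::nat)] \<cdot> b = \<zero>" using N by blast
qed (use B in auto)

text \<open>Starting from \<open>\<one>\<close>, all powers of \<open>x\<close> stay in one finite
  set, so two of them coincide.\<close>

lemma periodic_if_stabilizes_finite_span:
  assumes N: "N > 0" "[(N::nat)] \<cdot> \<one> = \<zero>" and B: "finite B" "B \<subseteq> carrier R"
    and x: "x \<in> carrier R" and one: "\<one> \<in> int_span B"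
    and xB: "\<And>y. y \<in> B \<Longrightarrow> x \<otimes> y \<in> int_span B"
  shows "periodic_elem R x"
proof -
  have pow: "x [^] (k::nat) \<in> int_span B" for k
  proof (induction k)
    case (Suc k)
    then show ?case using int_span_mult_left[OF x B(2) B(2) xB Suc] nat_pow_Suc2[OF x, of k] by simp
  qed (use one in simp)
  \<comment> \<open>Exponents are shifted by one because periodicity asks for positive
    exponents.\<close>
  have "\<not> inj (\<lambda>k. x [^] Suc k)"
    using finite_int_span[OF N B] pow finite_subset[of "range (\<lambda>k. x [^] Suc k)" "int_span B"]
      range_inj_infinite by blast
  then obtain i j where "i \<noteq> j" "x [^] Suc i = x [^] Suc j" by (auto simp: inj_on_def)
  then show ?thesis unfolding periodic_elem_def by (intro exI[of _ "Suc i"] exI[of _ "Suc j"]) auto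
qed

lemma periodic_elemE:
  assumes "periodic_elem R x"
  obtains m n :: nat where "m < n" "x [^] m = x [^] n"
  using assms unfolding periodic_elem_def by (metis nat_neq_iff)

lemma finite_powers_if_periodic:
  assumes x: "x \<in> carrier R" and per: "periodic_elem R x"
  shows "finite (range (\<lambda>i::nat. x [^] i))"
proof -
  obtain m n :: nat where mn: "m < n" "x [^] m = x [^] n" using per by (rule periodic_elemE)
  have "x [^] i \<in> (\<lambda>i. x [^] i) ` {..<n}" for i :: nat
  proof (induction i rule: less_induct)
    case (less i)
    show ?case
    proof (cases "i < n")
      case False
      \<comment> \<open>An exponent that is at least \<open>n\<close> drops by
        \<open>n - m\<close>.\<close>
      have "x [^] i = x [^] (i - n) \<otimes> x [^] n" using False x by (simp add: nat_pow_mult)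
      also have "\<dots> = x [^] (i - n + m)" using mn(2)[symmetric] x by (simp add: nat_pow_mult)
      finally show ?thesis using less[of "i - n + m"] False mn(1) by simp
    qed simp
  qed
  then have "range (\<lambda>i::nat. x [^] i) \<subseteq> (\<lambda>i. x [^] i) ` {..<n}" by blast
  then show ?thesis using finite_subset by blast
qed

text \<open>The finite additive span of the powers of \<open>x\<close> is stable under
  multiplication by \<open>\<one> \<ominus> x\<close>. This serves both for units
  \<open>\<one> \<ominus> q\<close> with \<open>q\<close> nilpotent and for the non-units of a local
  ring.\<close>

lemma periodic_one_minus:
  assumes N: "N > 0" "[(N::nat)] \<cdot> \<one> = \<zero>" and x: "x \<in> carrier R" and per: "periodic_elem R x"
  shows "periodic_elem R (\<one> \<ominus> x)"
proof (rule periodic_if_stabilizes_finite_span[OF N finite_powers_if_periodic[OF x per]])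
  let ?B = "range (\<lambda>i::nat. x [^] i)"
  show BR: "?B \<subseteq> carrier R" using x by auto
  have "x [^] (0::nat) \<in> int_span ?B" by (intro generate.incl) blast
  then show "\<one> \<in> int_span ?B" by simp
  fix y assume "y \<in> ?B"
  then obtain i :: nat where y: "y = x [^] i" by blast
  have "(\<one> \<ominus> x) \<otimes> y = x [^] i \<ominus> x [^] Suc i"
    unfolding y nat_pow_Suc2[OF x] using x nat_pow_closed[OF x, of i] by algebra
  moreover have "x [^] j \<in> int_span ?B" for j :: nat by (intro generate.incl) blast
  ultimately show "(\<one> \<ominus> x) \<otimes> y \<in> int_span ?B" using int_span_minus[OF BR] by metis
qed (use x in simp)

lemma Units_torsion_if_periodic:
  assumes x: "x \<in> Units R" and per: "periodic_elem R x"
  shows "\<exists>n>0. x [^] (n::nat) = \<one>"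
proof -
  obtain m n :: nat where mn: "m < n" "x [^] m = x [^] n" using per by (rule periodic_elemE)
  have "x [^] m \<otimes> x [^] (n - m) = x [^] m \<otimes> \<one>"
    using mn(1) mn(2)[symmetric] x by (simp add: nat_pow_mult Units_closed)
  then have "x [^] (n - m) = \<one>"
    using Units_l_cancel[OF Units_pow_closed[OF x]] x by (metis Units_closed nat_pow_closed one_closed)
  then show ?thesis using mn(1) by (intro exI[of _ "n - m"]) auto
qed

lemma periodic_if_torsion:
  assumes "x \<in> carrier R" "n > 0" "x [^] (n::nat) = \<one>"
  shows "periodic_elem R x"
  unfolding periodic_elem_def using assms
  by (intro exI[of _ "Suc n"] exI[of _ "Suc 0"]) auto

lemma periodic_if_nilpotent:
  assumes "x \<in> carrier R" "nilpotent_elem R x"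
  shows "periodic_elem R x"
proof -
  obtain n :: nat where "n > 0" "x [^] n = \<zero>" using assms(2) by (auto simp: nilpotent_elem_def)
  then show ?thesis unfolding periodic_elem_def using assms(1)
    by (intro exI[of _ "Suc n"] exI[of _ n]) auto
qed

text \<open>Geometric series: the witness \<open>y\<close> for \<open>k\<close> is the sum of the
  \<open>q [^] i\<close> with \<open>i < k\<close>, and it is a two-sided inverse as soon as
  \<open>q [^] k\<close> vanishes.\<close>

lemma one_minus_nilpotent_Units:
  assumes q: "q \<in> carrier R" and nil: "nilpotent_elem R q"
  shows "\<one> \<ominus> q \<in> Units R"
proof -
  obtain s :: nat where s: "q [^] s = \<zero>" using nil by (auto simp: nilpotent_elem_def)
  have "\<exists>y\<in>carrier R. (\<one> \<ominus> q) \<otimes> y = \<one> \<ominus> q [^] k \<and> y \<otimes> (\<one> \<ominus> q) = \<one> \<ominus> q [^] k" for k :: nat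
  proof (induction k)
    case 0
    show ?case using q by (intro bexI[of _ \<zero>]) (simp_all add: minus_eq r_neg)
  next
    case (Suc k)
    then obtain y where y: "y \<in> carrier R" "(\<one> \<ominus> q) \<otimes> y = \<one> \<ominus> q [^] k" "y \<otimes> (\<one> \<ominus> q) = \<one> \<ominus> q [^] k"
      by blast
    have c: "q [^] k \<in> carrier R" using q by simp
    have "(\<one> \<ominus> q) \<otimes> (y \<oplus> q [^] k) = (\<one> \<ominus> q) \<otimes> y \<oplus> (q [^] k \<ominus> q \<otimes> q [^] k)"
      using y(1) c q by algebra
    also have "\<dots> = \<one> \<ominus> q \<otimes> q [^] k" unfolding y(2) using c q by algebra
    finally have 1: "(\<one> \<ominus> q) \<otimes> (y \<oplus> q [^] k) = \<one> \<ominus> q [^] Suc k" using nat_pow_Suc2[OF q] by simp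
    have "(y \<oplus> q [^] k) \<otimes> (\<one> \<ominus> q) = y \<otimes> (\<one> \<ominus> q) \<oplus> (q [^] k \<ominus> q [^] k \<otimes> q)"
      using y(1) c q r_one[OF y(1)] r_one[OF c] by algebra
    also have "\<dots> = \<one> \<ominus> q [^] Suc k" unfolding y(3) nat_pow_Suc using c q by algebra
    finally show ?case using 1 y(1) c by blast
  qed
  from this[of s] obtain y where y: "y \<in> carrier R" "(\<one> \<ominus> q) \<otimes> y = \<one>" "y \<otimes> (\<one> \<ominus> q) = \<one>"
    unfolding s by (auto simp: minus_eq)
  then show ?thesis unfolding Units_def using q by auto
qed

section \<open>Positive characteristic\<close>

lemma add_pow_one_power: "([(a::nat)] \<cdot> \<one>) [^] (s::nat) = [(a ^ s)] \<cdot> \<one>"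
proof (induction s)
  case (Suc s)
  have "([(a ^ s)] \<cdot> \<one>) \<otimes> ([a] \<cdot> \<one>) = [a] \<cdot> ([(a ^ s)] \<cdot> \<one>)" by (simp add: add_pow_rdistr)
  also have "\<dots> = [(a ^ Suc s)] \<cdot> \<one>" by (simp add: add.nat_pow_pow mult.commute)
  finally show ?case using Suc by simp
qed simp

text \<open>Since \<open>2\<close> is central, \<open>p = 2 - q\<close> commutes with
  \<open>q\<close>, and the powers of \<open>p\<close> agree with those of \<open>2\<close> up to
  multiples of \<open>q\<close>. Then \<open>p [^] m = p [^] n\<close> makes the integer
  \<open>2 ^ n - 2 ^ m\<close> a multiple of \<open>q\<close> by a commuting factor, hence nilpotent
  in the ring.\<close>

lemma positive_char_if_semi_nil_clean:
  assumes "semi_nil_clean R"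
  shows "\<exists>N>0. [(N::nat)] \<cdot> \<one> = \<zero>"
proof -
  define t where "t = [(2::nat)] \<cdot> \<one>"
  have t: "t \<in> carrier R" by (simp add: t_def)
  obtain p q where p: "p \<in> carrier R" "periodic_elem R p" and q: "q \<in> carrier R" "nilpotent_elem R q"
    and tpq: "t = p \<oplus> q"
    using assms t unfolding semi_nil_clean_def by blast
  have p_eq: "p = t \<ominus> q" unfolding tpq using p q by algebra
  have tq: "t \<otimes> q = q \<otimes> t" unfolding t_def using q by (simp add: add_pow_ldistr add_pow_rdistr)
  obtain s :: nat where s: "q [^] s = \<zero>" using q by (auto simp: nilpotent_elem_def)
  obtain m n :: nat where mn: "m < n" "p [^] m = p [^] n" using p(2) by (rule periodic_elemE)
  \<comment> \<open>The cofactor \<open>y\<close> has to commute with \<open>q\<close>, so that a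
    power of the final product \<open>q \<otimes> z\<close> splits and contains
    \<open>q [^] s\<close>.\<close>
  have expand: "\<exists>y\<in>carrier R. y \<otimes> q = q \<otimes> y \<and> p [^] k = t [^] k \<ominus> q \<otimes> y" for k :: nat
  proof (induction k)
    case 0
    show ?case using q by (intro bexI[of _ \<zero>]) (simp_all add: minus_eq)
  next
    case (Suc k)
    then obtain y where y: "y \<in> carrier R" "y \<otimes> q = q \<otimes> y" "p [^] k = t [^] k \<ominus> q \<otimes> y" by blast
    define c where "c = t [^] k"
    have c: "c \<in> carrier R" "c \<otimes> q = q \<otimes> c"
      unfolding c_def using t q tq by (auto intro: group_commutes_pow)
    \<comment> \<open>Read off from the product of \<open>c \<ominus> q \<otimes> y\<close> and
      \<open>t \<ominus> q\<close> by factoring out \<open>q\<close> on the left.\<close>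
    define z where "z = c \<oplus> y \<otimes> t \<ominus> y \<otimes> q"
    have "p [^] Suc k = c \<otimes> t \<ominus> c \<otimes> q \<ominus> q \<otimes> y \<otimes> t \<oplus> q \<otimes> y \<otimes> q"
      unfolding nat_pow_Suc y(3) c_def[symmetric] unfolding p_eq using c(1) y(1) t q(1) by algebra
    also have "\<dots> = c \<otimes> t \<ominus> q \<otimes> z"
      unfolding z_def c(2) using c(1) y(1) t q(1) by algebra
    finally have "p [^] Suc k = t [^] Suc k \<ominus> q \<otimes> z" by (simp add: c_def)
    moreover have "z \<otimes> q = q \<otimes> z"
    proof -
      have 1: "y \<otimes> t \<otimes> q = q \<otimes> (y \<otimes> t)" using y t q tq by (metis m_assoc)
      have 2: "y \<otimes> q \<otimes> q = q \<otimes> (y \<otimes> q)" using y q by (metis m_assoc)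
      have "z \<otimes> q = c \<otimes> q \<oplus> y \<otimes> t \<otimes> q \<ominus> y \<otimes> q \<otimes> q"
        unfolding z_def using c(1) y(1) t q(1) by algebra
      also have "\<dots> = q \<otimes> z"
        unfolding z_def c(2) 1 2 using c(1) y(1) t q(1) by algebra
      finally show ?thesis .
    qed
    moreover have "z \<in> carrier R" unfolding z_def using c y t q by simp
    ultimately show ?case by blast
  qed
  obtain y1 where y1: "y1 \<in> carrier R" "y1 \<otimes> q = q \<otimes> y1" "p [^] m = t [^] m \<ominus> q \<otimes> y1"
    using expand[of m] by blast
  obtain y2 where y2: "y2 \<in> carrier R" "y2 \<otimes> q = q \<otimes> y2" "p [^] n = t [^] n \<ominus> q \<otimes> y2"
    using expand[of n] by blast
  define z where "z = y2 \<ominus> y1"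
  have z: "z \<in> carrier R" using y1 y2 by (simp add: z_def)
  have qz: "q \<otimes> z = z \<otimes> q"
  proof -
    have "z \<otimes> q = y2 \<otimes> q \<ominus> y1 \<otimes> q" unfolding z_def using y1(1) y2(1) q(1) by algebra
    also have "\<dots> = q \<otimes> z" unfolding y1(2) y2(2) z_def using y1(1) y2(1) q(1) by algebra
    finally show ?thesis by simp
  qed
  have two: "t [^] k = [(2 ^ k :: nat)] \<cdot> \<one>" for k :: nat
    unfolding t_def by (rule add_pow_one_power)
  have "[(2 ^ n - 2 ^ m :: nat)] \<cdot> \<one> = q \<otimes> z"
  proof -
    have tm: "t [^] m \<in> carrier R" "t [^] n \<in> carrier R" using t by auto
    have "[(2 ^ n :: nat)] \<cdot> \<one> = [(2 ^ n - 2 ^ m :: nat)] \<cdot> \<one> \<oplus> [(2 ^ m :: nat)] \<cdot> \<one>"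
      using mn(1) by (simp add: add.nat_pow_mult)
    then have e: "t [^] n = [(2 ^ n - 2 ^ m :: nat)] \<cdot> \<one> \<oplus> t [^] m" by (simp add: two)
    have "t [^] m \<ominus> q \<otimes> y1 = t [^] n \<ominus> q \<otimes> y2" using mn(2) y1(3) y2(3) by simp
    then have "t [^] m \<ominus> q \<otimes> y1 \<oplus> q \<otimes> y2 \<ominus> t [^] m = t [^] n \<ominus> q \<otimes> y2 \<oplus> q \<otimes> y2 \<ominus> t [^] m"
      by simp
    then have "q \<otimes> z = t [^] n \<ominus> t [^] m"
      unfolding z_def using tm y1(1) y2(1) q(1) by algebra
    moreover have "[(2 ^ n - 2 ^ m :: nat)] \<cdot> \<one> = t [^] n \<ominus> t [^] m"
    proof -
      have "[(2 ^ n - 2 ^ m :: nat)] \<cdot> \<one> \<in> carrier R" by simp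
      then show ?thesis unfolding e using tm(1) by algebra
    qed
    ultimately show ?thesis by simp
  qed
  then have "[((2 ^ n - 2 ^ m) ^ s :: nat)] \<cdot> \<one> = q [^] s \<otimes> z [^] s"
    using pow_mult_distrib[OF qz q(1) z, of s] by (simp add: add_pow_one_power[symmetric])
  then have "[((2 ^ n - 2 ^ m) ^ s :: nat)] \<cdot> \<one> = \<zero>" using s z by simp
  moreover have "(2 ^ n - 2 ^ m :: nat) ^ s > 0" using mn(1) by simp
  ultimately show ?thesis by blast
qed

section \<open>Torsion of the units\<close>

text \<open>The span of \<open>B n\<close> behaves like the polynomials in \<open>g\<close> of
  degree below \<open>n\<close>, with left coefficients in the span of \<open>W\<close>; invariance
  of \<open>W\<close> lets \<open>g\<close> move past coefficients. Each \<open>p [^] n\<close> is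
  monic of degree \<open>n\<close> in this sense, so equating two powers of \<open>p\<close> gives a
  monic relation for \<open>g\<close>.\<close>

theorem Units_torsion_if_semi_nil_clean:
  assumes snc: "semi_nil_clean R" and ln: "locally_nilpotent (units_of R)" and g: "g \<in> Units R"
  shows "\<exists>n>0. g [^] (n::nat) = \<one>"
proof -
  interpret U: group "units_of R" by (rule units_group)
  obtain N :: nat where N: "N > 0" "[N] \<cdot> \<one> = \<zero>"
    using positive_char_if_semi_nil_clean[OF snc] by blast
  have gR: "g \<in> carrier R" using g by (rule Units_closed)
  obtain p q where p: "p \<in> carrier R" "periodic_elem R p" and q: "q \<in> carrier R" "nilpotent_elem R q"
    and gpq: "g = p \<oplus> q"
    using snc gR unfolding semi_nil_clean_def by blast
  define v where "v = \<one> \<ominus> q"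
  have v: "v \<in> Units R" unfolding v_def using q by (rule one_minus_nilpotent_Units)
  have "periodic_elem R v"
    unfolding v_def using periodic_one_minus[OF N q(1) periodic_if_nilpotent[OF q]] .
  then obtain k :: nat where k: "k > 0" "v [^] k = \<one>" using Units_torsion_if_periodic[OF v] by blast
  have "\<exists>W. subgroup W (units_of R) \<and> finite W \<and> v \<in> W \<and>
          (\<forall>w\<in>W. g \<otimes>\<^bsub>units_of R\<^esub> w \<otimes>\<^bsub>units_of R\<^esub> inv\<^bsub>units_of R\<^esub> g \<in> W)"
    using v g k by (intro U.finite_conj_invariant_subgroup_if_locally_nilpotent[OF ln, where n = k])
      (auto simp: units_of_carrier units_of_pow units_of_one)
  then obtain W where sub: "subgroup W (units_of R)" and W: "finite W" "v \<in> W"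
    and "\<forall>w\<in>W. g \<otimes>\<^bsub>units_of R\<^esub> w \<otimes>\<^bsub>units_of R\<^esub> inv\<^bsub>units_of R\<^esub> g \<in> W" by blast
  then have conj: "\<And>w. w \<in> W \<Longrightarrow> g \<otimes> w \<otimes> inv g \<in> W"
    by (simp add: units_of_mult units_of_inv g)
  have WU: "W \<subseteq> Units R" using subgroup.subset[OF sub] by (simp add: units_of_carrier)
  then have WR: "W \<subseteq> carrier R" by auto
  have W1: "\<one> \<in> W" using subgroup.one_closed[OF sub] by (simp add: units_of_one)
  have Wm: "w \<otimes> w' \<in> W" if "w \<in> W" "w' \<in> W" for w w'
    using subgroup.m_closed[OF sub that] by (simp add: units_of_mult)
  define B where "B = (\<lambda>n. (\<lambda>(w, i::nat). w \<otimes> g [^] i) ` (W \<times> {..<n}))"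
  have Bfin: "finite (B n)" for n using W(1) by (simp add: B_def)
  have BI: "w \<otimes> g [^] i \<in> B n" if "w \<in> W" "i < n" for w i n using that by (auto simp: B_def)
  have BR: "B n \<subseteq> carrier R" for n using WR gR by (auto simp: B_def)
  have Bmono: "int_span (B m) \<subseteq> int_span (B n)" if "m \<le> n" for m n
    using that unfolding B_def by (intro add.mono_generate image_mono) auto
  \<comment> \<open>Passing \<open>g\<close> to the right of \<open>w\<close> costs a conjugation,
    under which \<open>W\<close> is invariant.\<close>
  have gw: "g \<otimes> (w \<otimes> g [^] i) = (g \<otimes> w \<otimes> inv g) \<otimes> g [^] Suc i" if w: "w \<in> W" for w and i :: nat
  proof -
    have wR: "w \<in> carrier R" using w WR by auto
    have "(g \<otimes> w \<otimes> inv g) \<otimes> g [^] Suc i = g \<otimes> w \<otimes> (inv g \<otimes> g) \<otimes> g [^] i"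
      using wR gR g by (simp only: nat_pow_Suc2[OF gR] m_assoc m_closed Units_inv_closed nat_pow_closed)
    then show ?thesis using wR gR g by (simp add: m_assoc)
  qed
  have gB: "g \<otimes> y \<in> int_span (B (Suc n))" if "y \<in> int_span (B n)" for y n
  proof (rule int_span_mult_left[OF gR BR BR _ that])
    fix y assume "y \<in> B n"
    then obtain w i where "w \<in> W" "i < n" "y = w \<otimes> g [^] i" by (auto simp: B_def)
    then show "g \<otimes> y \<in> int_span (B (Suc n))" using gw conj BI[of _ "Suc i"]
      by (auto simp del: nat_pow_Suc Group.nat_pow_Suc intro!: generate.incl)
  qed
  have wB: "w \<otimes> y \<in> int_span (B n)" if w: "w \<in> W" and y: "y \<in> int_span (B n)" for w y n
  proof (rule int_span_mult_left[OF _ BR BR _ y])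
    show "w \<in> carrier R" using w WR by auto
    fix y assume "y \<in> B n"
    then obtain w' i where *: "w' \<in> W" "i < n" "y = w' \<otimes> g [^] i" by (auto simp: B_def)
    then have "w \<otimes> y = (w \<otimes> w') \<otimes> g [^] i" using w WR gR by (simp add: m_assoc subset_iff)
    then show "w \<otimes> y \<in> int_span (B n)" using BI[OF Wm[OF w *(1)] *(2)] by (auto intro: generate.incl)
  qed
  have gpow: "g [^] i \<in> int_span (B n)" if "i < n" for i n :: nat
    using generate.incl[OF BI[OF W1 that]] gR by simp
  have vR: "v \<in> carrier R" using v by auto
  have p_eq: "p = g \<oplus> v \<ominus> \<one>" unfolding gpq v_def using p(1) q(1) by algebra
  \<comment> \<open>The leading coefficient is exactly \<open>\<one>\<close>; everything else has
    lower degree.\<close>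
  have expand: "\<exists>y\<in>int_span (B n). p [^] n = g [^] n \<oplus> y" for n :: nat
  proof (induction n)
    case 0
    then show ?case using generate.one[of "add_monoid R" "B 0"] by (intro bexI[of _ \<zero>]) auto
  next
    case (Suc n)
    then obtain y where y: "y \<in> int_span (B n)" "p [^] n = g [^] n \<oplus> y" by blast
    have yR: "y \<in> carrier R" using y BR int_span_closed by blast
    have gn: "g [^] n \<in> carrier R" using gR by simp
    \<comment> \<open>This is the product of \<open>g \<oplus> v \<ominus> \<one>\<close> and
      \<open>g [^] n \<oplus> y\<close> without its leading term.\<close>
    define z where "z = v \<otimes> g [^] n \<ominus> g [^] n \<oplus> g \<otimes> y \<oplus> v \<otimes> y \<ominus> y"
    have "p [^] Suc n = g \<otimes> g [^] n \<oplus> z"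
      unfolding nat_pow_Suc2[OF p(1)] y(2) z_def unfolding p_eq using gR vR yR gn by algebra
    then have "p [^] Suc n = g [^] Suc n \<oplus> z" using nat_pow_Suc2[OF gR] by simp
    moreover have "z \<in> int_span (B (Suc n))"
      using y(1) Bmono[of n "Suc n"] gB wB[OF W(2)] gpow[of n "Suc n"] unfolding z_def
      by (intro int_span_minus int_span_add BR) auto
    ultimately show ?case by blast
  qed
  obtain m n :: nat where mn: "m < n" "p [^] m = p [^] n" using p(2) by (rule periodic_elemE)
  \<comment> \<open>As \<open>m < n\<close>, the whole of \<open>p [^] m\<close> has degree below
    \<open>n\<close>, which leaves \<open>g [^] n\<close> as a combination of lower terms.\<close>
  have gn: "g [^] n \<in> int_span (B n)"
  proof -
    obtain y where y: "y \<in> int_span (B n)" "p [^] n = g [^] n \<oplus> y" using expand by blast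
    obtain y' where y': "y' \<in> int_span (B m)" "p [^] m = g [^] m \<oplus> y'" using expand by blast
    have R: "y \<in> carrier R" "y' \<in> carrier R" "g [^] n \<in> carrier R" "g [^] m \<in> carrier R"
      using int_span_closed[OF BR y(1)] int_span_closed[OF BR y'(1)] gR by auto
    have "g [^] n = p [^] n \<ominus> y" unfolding y(2) using R by algebra
    also have "\<dots> = g [^] m \<oplus> y' \<ominus> y" using mn(2) y'(2) by simp
    also have "\<dots> \<in> int_span (B n)"
      using gpow[OF mn(1)] y(1) y'(1) Bmono[of m n] mn(1) by (intro int_span_minus int_span_add BR) auto
    finally show ?thesis .
  qed
  have "periodic_elem R g"
  proof (rule periodic_if_stabilizes_finite_span[OF N Bfin BR gR])
    show "\<one> \<in> int_span (B n)" using gpow[of 0 n] mn(1) by simp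
    fix y assume "y \<in> B n"
    then obtain w i where *: "w \<in> W" "i < n" "y = w \<otimes> g [^] i" by (auto simp: B_def)
    show "g \<otimes> y \<in> int_span (B n)"
    \<comment> \<open>Only the top exponent leaves the range, and there \<open>gn\<close> rewrites
      \<open>g [^] n\<close> in lower degree.\<close>
    proof (cases "Suc i = n")
      case True
      then show ?thesis using * gw wB[OF conj gn] by metis
    next
      case False
      then have "Suc i < n" using * by simp
      then show ?thesis using * gw[OF *(1), of i] BI[OF conj[OF *(1)], of "Suc i" n]
        by (metis generate.incl)
    qed
  qed
  then show ?thesis using Units_torsion_if_periodic[OF g] by blast
qed

end

subsection \<open>Group rings and local rings\<close>

lemma (in ring) finsum_swap:
  assumes "finite A" "finite B" "\<And>u v. u \<in> A \<Longrightarrow> v \<in> B \<Longrightarrow> f u v \<in> carrier R"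
  shows "(\<Oplus>u\<in>A. \<Oplus>v\<in>B. f u v) = (\<Oplus>v\<in>B. \<Oplus>u\<in>A. f u v)"
  using assms(1,3)
proof (induction A)
  case empty
  then show ?case by (simp add: finsum_zero)
next
  case (insert a A)
  have a: "(\<lambda>v. f a v) \<in> B \<rightarrow> carrier R" using insert.prems by simp
  have A: "(\<lambda>v. \<Oplus>u\<in>A. f u v) \<in> B \<rightarrow> carrier R" using insert.prems by (auto intro!: finsum_closed)
  have "(\<Oplus>u\<in>insert a A. \<Oplus>v\<in>B. f u v) = (\<Oplus>v\<in>B. f a v) \<oplus> (\<Oplus>u\<in>A. \<Oplus>v\<in>B. f u v)"
    using insert by (intro finsum_insert) (auto intro!: finsum_closed)
  also have "\<dots> = (\<Oplus>v\<in>B. f a v) \<oplus> (\<Oplus>v\<in>B. \<Oplus>u\<in>A. f u v)"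
    using insert.IH insert.prems by simp
  also have "\<dots> = (\<Oplus>v\<in>B. f a v \<oplus> (\<Oplus>u\<in>A. f u v))"
    using finsum_addf[OF a A] by simp
  also have "\<dots> = (\<Oplus>v\<in>B. \<Oplus>u\<in>insert a A. f u v)"
  proof (rule finsum_cong'[OF refl])
    fix v assume "v \<in> B"
    then show "f a v \<oplus> (\<Oplus>u\<in>A. f u v) = (\<Oplus>u\<in>insert a A. f u v)"
      using insert by (intro finsum_insert[symmetric]) auto
  qed (use insert in \<open>auto intro!: finsum_closed\<close>)
  finally show ?case .
qed

locale ring_and_group = ring R + G: group G
  for R :: "('r, 'm) ring_scheme" (structure) and G :: "('g, 'n) monoid_scheme"
begin

abbreviation RG where "RG \<equiv> group_ring R G"

text \<open>Any finite set outside which \<open>f\<close> vanishes may replace the support. This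
  avoids computing supports of sums and products, where cancellation can occur.\<close>

lemma carrier_RG:
  "f \<in> carrier RG \<longleftrightarrow> (\<forall>x. f x \<in> carrier R) \<and> (\<exists>A. finite A \<and> A \<subseteq> carrier G \<and> (\<forall>x. x \<notin> A \<longrightarrow> f x = \<zero>))"
  (is "?L \<longleftrightarrow> ?C \<and> (\<exists>A. ?P A)")
proof
  assume f: ?L
  then have "?P (coeff_support R f)" by (simp add: group_ring_def coeff_support_def)
  moreover have ?C using f by (auto simp: group_ring_def)
  ultimately show "?C \<and> (\<exists>A. ?P A)" by blast
next
  assume "?C \<and> (\<exists>A. ?P A)"
  then obtain A where A: "?C" "finite A" "A \<subseteq> carrier G" "\<forall>x. x \<notin> A \<longrightarrow> f x = \<zero>" by blast
  then have "coeff_support R f \<subseteq> A" unfolding coeff_support_def by blast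
  then show ?L using A(1-3) finite_subset[of "coeff_support R f" A] by (auto simp: group_ring_def)
qed

lemma RG_closed [simp]: "f \<in> carrier RG \<Longrightarrow> f x \<in> carrier R"
  by (simp add: carrier_RG)

lemma RG_zero_outside: "f \<in> carrier RG \<Longrightarrow> x \<notin> carrier G \<Longrightarrow> f x = \<zero>"
  by (auto simp: carrier_RG)

lemma zero_RG: "\<zero>\<^bsub>RG\<^esub> = (\<lambda>x. \<zero>)" and one_RG: "\<one>\<^bsub>RG\<^esub> = (\<lambda>x. if x = \<one>\<^bsub>G\<^esub> then \<one> else \<zero>)"
  and add_RG: "f \<oplus>\<^bsub>RG\<^esub> h = (\<lambda>x. f x \<oplus> h x)"
  by (simp_all add: group_ring_def)

text \<open>In a pair with product \<open>x\<close> the first entry determines the second, so the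
  convolution is a sum over one variable. It may run over any finite \<open>A\<close> containing the
  support, as the extra terms are zero.\<close>

lemma mult_RG:
  assumes f: "f \<in> carrier RG" and h: "h \<in> carrier RG" and x: "x \<in> carrier G"
    and A: "finite A" "A \<subseteq> carrier G" "\<And>u. u \<notin> A \<Longrightarrow> f u = \<zero>"
  shows "(f \<otimes>\<^bsub>RG\<^esub> h) x = (\<Oplus>u\<in>A. f u \<otimes> h (inv\<^bsub>G\<^esub> u \<otimes>\<^bsub>G\<^esub> x))"
proof -
  let ?B = "{u \<in> A. f u \<noteq> \<zero> \<and> h (inv\<^bsub>G\<^esub> u \<otimes>\<^bsub>G\<^esub> x) \<noteq> \<zero>}"
  let ?p = "\<lambda>u. (u, inv\<^bsub>G\<^esub> u \<otimes>\<^bsub>G\<^esub> x)"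
  have "{(u, v). u \<in> coeff_support R f \<and> v \<in> coeff_support R h \<and> u \<otimes>\<^bsub>G\<^esub> v = x} = ?p ` ?B"
  proof (intro equalityI subsetI)
    fix p assume "p \<in> {(u, v). u \<in> coeff_support R f \<and> v \<in> coeff_support R h \<and> u \<otimes>\<^bsub>G\<^esub> v = x}"
    then obtain u v where p: "p = (u, v)" "f u \<noteq> \<zero>" "h v \<noteq> \<zero>" "u \<otimes>\<^bsub>G\<^esub> v = x"
      by (auto simp: coeff_support_def)
    then have "u \<in> carrier G" "v \<in> carrier G" using RG_zero_outside f h by auto
    then have "v = inv\<^bsub>G\<^esub> u \<otimes>\<^bsub>G\<^esub> x" using p(4) by (metis G.inv_solve_left G.m_closed)
    then show "p \<in> ?p ` ?B" using p A(3) by auto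
  next
    fix p assume "p \<in> ?p ` ?B"
    then obtain u where u: "u \<in> A" "f u \<noteq> \<zero>" "h (inv\<^bsub>G\<^esub> u \<otimes>\<^bsub>G\<^esub> x) \<noteq> \<zero>" "p = ?p u" by auto
    then have "u \<in> carrier G" using A by auto
    then have "u \<otimes>\<^bsub>G\<^esub> (inv\<^bsub>G\<^esub> u \<otimes>\<^bsub>G\<^esub> x) = x" using x by (simp add: G.m_assoc[symmetric])
    then show "p \<in> {(u, v). u \<in> coeff_support R f \<and> v \<in> coeff_support R h \<and> u \<otimes>\<^bsub>G\<^esub> v = x}"
      using u by (auto simp: coeff_support_def)
  qed
  then have "(f \<otimes>\<^bsub>RG\<^esub> h) x = finsum R (\<lambda>(u, v). f u \<otimes> h v) (?p ` ?B)"
    by (simp add: group_ring_def)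
  also have "\<dots> = (\<Oplus>u\<in>?B. f u \<otimes> h (inv\<^bsub>G\<^esub> u \<otimes>\<^bsub>G\<^esub> x))"
    using f h by (subst finsum_reindex) (auto simp: inj_on_def)
  also have "\<dots> = (\<Oplus>u\<in>A. f u \<otimes> h (inv\<^bsub>G\<^esub> u \<otimes>\<^bsub>G\<^esub> x))"
    using A f h by (intro add.finprod_mono_neutral_cong_left) auto
  finally show ?thesis .
qed

lemma mult_RG_outside:
  assumes f: "f \<in> carrier RG" and h: "h \<in> carrier RG" and x: "x \<notin> carrier G"
  shows "(f \<otimes>\<^bsub>RG\<^esub> h) x = \<zero>"
proof -
  have empty: "{(u, v). u \<in> coeff_support R f \<and> v \<in> coeff_support R h \<and> u \<otimes>\<^bsub>G\<^esub> v = x} = {}"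
  proof (intro equals0I)
    fix p assume "p \<in> {(u, v). u \<in> coeff_support R f \<and> v \<in> coeff_support R h \<and> u \<otimes>\<^bsub>G\<^esub> v = x}"
    then obtain u v where uv: "f u \<noteq> \<zero>" "h v \<noteq> \<zero>" "u \<otimes>\<^bsub>G\<^esub> v = x"
      by (auto simp: coeff_support_def)
    have "u \<in> carrier G" "v \<in> carrier G"
      using uv(1,2) RG_zero_outside[OF f, of u] RG_zero_outside[OF h, of v] by blast+
    then show False using uv(3) x G.m_closed by blast
  qed
  have "(f \<otimes>\<^bsub>RG\<^esub> h) x = finsum R (\<lambda>(u, v). f u \<otimes> h v)
      {(u, v). u \<in> coeff_support R f \<and> v \<in> coeff_support R h \<and> u \<otimes>\<^bsub>G\<^esub> v = x}"
    by (simp only: group_ring_def monoid.simps)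
  then show ?thesis unfolding empty by (simp add: finsum_empty)
qed

lemma mult_RG_closed:
  assumes f: "f \<in> carrier RG" and h: "h \<in> carrier RG"
  shows "f \<otimes>\<^bsub>RG\<^esub> h \<in> carrier RG"
proof -
  obtain A where A: "finite A" "A \<subseteq> carrier G" "\<And>u. u \<notin> A \<Longrightarrow> f u = \<zero>"
    using f by (auto simp: carrier_RG)
  obtain B where B: "finite B" "B \<subseteq> carrier G" "\<And>u. u \<notin> B \<Longrightarrow> h u = \<zero>"
    using h by (auto simp: carrier_RG)
  have closed: "(f \<otimes>\<^bsub>RG\<^esub> h) x \<in> carrier R" for x
    using mult_RG[OF f h _ A, of x] mult_RG_outside[OF f h, of x] f h
    by (cases "x \<in> carrier G") (auto intro!: finsum_closed)
  \<comment> \<open>Nonzero coefficients of the product can only occur at products of an element of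
    \<open>A\<close> with one of \<open>B\<close>.\<close>
  define T where "T = (\<lambda>(u, v). u \<otimes>\<^bsub>G\<^esub> v) ` (A \<times> B)"
  have T: "finite T" "T \<subseteq> carrier G" using A B by (auto simp: T_def subset_iff)
  have "(f \<otimes>\<^bsub>RG\<^esub> h) x = \<zero>" if x: "x \<notin> T" for x
  proof (cases "x \<in> carrier G")
    case True
    have "f u \<otimes> h (inv\<^bsub>G\<^esub> u \<otimes>\<^bsub>G\<^esub> x) = \<zero>" if u: "u \<in> A" for u
    proof -
      have "u \<in> carrier G" using u A by auto
      then have "u \<otimes>\<^bsub>G\<^esub> (inv\<^bsub>G\<^esub> u \<otimes>\<^bsub>G\<^esub> x) = x" using True by (simp add: G.m_assoc[symmetric])
      then have "x = (\<lambda>(u, v). u \<otimes>\<^bsub>G\<^esub> v) (u, inv\<^bsub>G\<^esub> u \<otimes>\<^bsub>G\<^esub> x)" by simp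
      then have "inv\<^bsub>G\<^esub> u \<otimes>\<^bsub>G\<^esub> x \<notin> B" using x u unfolding T_def by (metis SigmaI image_eqI)
      then show ?thesis using B(3) f by simp
    qed
    then have "(\<Oplus>u\<in>A. f u \<otimes> h (inv\<^bsub>G\<^esub> u \<otimes>\<^bsub>G\<^esub> x)) = \<zero>" by (rule add.finprod_one_eqI)
    then show ?thesis using mult_RG[OF f h True A] by simp
  qed (rule mult_RG_outside[OF f h])
  then show ?thesis unfolding carrier_RG by (intro conjI exI[of _ T] allI impI closed T)
qed

text \<open>Both sides equal the double sum of \<open>f u\<close>, \<open>h\<close> at
  \<open>inv u\<close> times \<open>t\<close>, and \<open>k\<close> at \<open>inv t\<close> times
  \<open>x\<close>, over \<open>u\<close> and \<open>t\<close>; the two orders of summation give the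
  two bracketings.\<close>

lemma mult_RG_assoc:
  assumes f: "f \<in> carrier RG" and h: "h \<in> carrier RG" and k: "k \<in> carrier RG"
  shows "f \<otimes>\<^bsub>RG\<^esub> h \<otimes>\<^bsub>RG\<^esub> k = f \<otimes>\<^bsub>RG\<^esub> (h \<otimes>\<^bsub>RG\<^esub> k)"
proof
  fix x
  note fh = mult_RG_closed[OF f h] and hk = mult_RG_closed[OF h k]
  show "(f \<otimes>\<^bsub>RG\<^esub> h \<otimes>\<^bsub>RG\<^esub> k) x = (f \<otimes>\<^bsub>RG\<^esub> (h \<otimes>\<^bsub>RG\<^esub> k)) x"
  proof (cases "x \<in> carrier G")
    case False
    then show ?thesis by (simp add: mult_RG_outside fh hk f k)
  next
    case x: True
    obtain A where A: "finite A" "A \<subseteq> carrier G" "\<And>u. u \<notin> A \<Longrightarrow> f u = \<zero>"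
      using f by (auto simp: carrier_RG)
    obtain B where B: "finite B" "B \<subseteq> carrier G" "\<And>u. u \<notin> B \<Longrightarrow> h u = \<zero>"
      using h by (auto simp: carrier_RG)
    obtain C where C: "finite C" "C \<subseteq> carrier G" "\<And>u. u \<notin> C \<Longrightarrow> (f \<otimes>\<^bsub>RG\<^esub> h) u = \<zero>"
      using fh by (auto simp: carrier_RG)
    \<comment> \<open>\<open>T\<close> has to cover the support of the product of \<open>f\<close>
      and \<open>h\<close>, for the outer expansion, and all products from \<open>A\<close> and
      \<open>B\<close>, for the substitution of \<open>u\<close> times \<open>v\<close> for
      \<open>t\<close> in \<open>inner\<close>.\<close>
    define T where "T = C \<union> (\<lambda>(u, v). u \<otimes>\<^bsub>G\<^esub> v) ` (A \<times> B)"
    have T: "finite T" "T \<subseteq> carrier G" using A B C by (auto simp: T_def subset_iff)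
    have inner: "(\<Oplus>t\<in>T. h (inv\<^bsub>G\<^esub> u \<otimes>\<^bsub>G\<^esub> t) \<otimes> k (inv\<^bsub>G\<^esub> t \<otimes>\<^bsub>G\<^esub> x))
        = (h \<otimes>\<^bsub>RG\<^esub> k) (inv\<^bsub>G\<^esub> u \<otimes>\<^bsub>G\<^esub> x)" if u: "u \<in> A" for u
    proof -
      have uG: "u \<in> carrier G" using u A by auto
      have cancel: "inv\<^bsub>G\<^esub> u \<otimes>\<^bsub>G\<^esub> (u \<otimes>\<^bsub>G\<^esub> v) = v" "u \<otimes>\<^bsub>G\<^esub> (inv\<^bsub>G\<^esub> u \<otimes>\<^bsub>G\<^esub> v) = v"
        if "v \<in> carrier G" for v
        using uG that by (simp_all add: G.m_assoc[symmetric])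
      have "(\<Oplus>t\<in>T. h (inv\<^bsub>G\<^esub> u \<otimes>\<^bsub>G\<^esub> t) \<otimes> k (inv\<^bsub>G\<^esub> t \<otimes>\<^bsub>G\<^esub> x)) =
        (\<Oplus>t\<in>(\<lambda>v. u \<otimes>\<^bsub>G\<^esub> v) ` B. h (inv\<^bsub>G\<^esub> u \<otimes>\<^bsub>G\<^esub> t) \<otimes> k (inv\<^bsub>G\<^esub> t \<otimes>\<^bsub>G\<^esub> x))"
      proof (rule add.finprod_mono_neutral_cong_right)
        show "(\<lambda>v. u \<otimes>\<^bsub>G\<^esub> v) ` B \<subseteq> T" using u by (auto simp: T_def)
        show "h (inv\<^bsub>G\<^esub> u \<otimes>\<^bsub>G\<^esub> t) \<otimes> k (inv\<^bsub>G\<^esub> t \<otimes>\<^bsub>G\<^esub> x) = \<zero>"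
          if t: "t \<in> T - (\<lambda>v. u \<otimes>\<^bsub>G\<^esub> v) ` B" for t
        proof -
          have "u \<otimes>\<^bsub>G\<^esub> (inv\<^bsub>G\<^esub> u \<otimes>\<^bsub>G\<^esub> t) = t" using t T by (intro cancel) auto
          then have "inv\<^bsub>G\<^esub> u \<otimes>\<^bsub>G\<^esub> t \<notin> B" using t by (metis DiffE image_eqI)
          then show ?thesis using B(3) k by simp
        qed
      qed (use T h k in auto)
      also have "\<dots> = (\<Oplus>v\<in>B. h (inv\<^bsub>G\<^esub> u \<otimes>\<^bsub>G\<^esub> (u \<otimes>\<^bsub>G\<^esub> v)) \<otimes> k (inv\<^bsub>G\<^esub> (u \<otimes>\<^bsub>G\<^esub> v) \<otimes>\<^bsub>G\<^esub> x))"
      proof (rule finsum_reindex)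
        show "inj_on (\<lambda>v. u \<otimes>\<^bsub>G\<^esub> v) B" using uG B by (auto simp: inj_on_def subset_iff)
      qed (use h k in auto)
      also have "\<dots> = (\<Oplus>v\<in>B. h v \<otimes> k (inv\<^bsub>G\<^esub> v \<otimes>\<^bsub>G\<^esub> (inv\<^bsub>G\<^esub> u \<otimes>\<^bsub>G\<^esub> x)))"
      proof (rule finsum_cong'[OF refl])
        fix v assume "v \<in> B"
        then have "v \<in> carrier G" using B by auto
        then show "h (inv\<^bsub>G\<^esub> u \<otimes>\<^bsub>G\<^esub> (u \<otimes>\<^bsub>G\<^esub> v)) \<otimes> k (inv\<^bsub>G\<^esub> (u \<otimes>\<^bsub>G\<^esub> v) \<otimes>\<^bsub>G\<^esub> x) =
            h v \<otimes> k (inv\<^bsub>G\<^esub> v \<otimes>\<^bsub>G\<^esub> (inv\<^bsub>G\<^esub> u \<otimes>\<^bsub>G\<^esub> x))"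
          using uG x by (simp add: cancel G.inv_mult_group G.m_assoc)
      qed (use h k in auto)
      also have "\<dots> = (h \<otimes>\<^bsub>RG\<^esub> k) (inv\<^bsub>G\<^esub> u \<otimes>\<^bsub>G\<^esub> x)"
        using mult_RG[OF h k _ B] uG x by simp
      finally show ?thesis .
    qed
    have "(f \<otimes>\<^bsub>RG\<^esub> h \<otimes>\<^bsub>RG\<^esub> k) x = (\<Oplus>t\<in>T. (f \<otimes>\<^bsub>RG\<^esub> h) t \<otimes> k (inv\<^bsub>G\<^esub> t \<otimes>\<^bsub>G\<^esub> x))"
      using C(3) by (intro mult_RG[OF fh k x T]) (auto simp: T_def)
    also have "\<dots> = (\<Oplus>t\<in>T. \<Oplus>u\<in>A. f u \<otimes> (h (inv\<^bsub>G\<^esub> u \<otimes>\<^bsub>G\<^esub> t) \<otimes> k (inv\<^bsub>G\<^esub> t \<otimes>\<^bsub>G\<^esub> x)))"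
    proof (rule finsum_cong'[OF refl])
      fix t assume "t \<in> T"
      then have "t \<in> carrier G" using T by auto
      then show "(f \<otimes>\<^bsub>RG\<^esub> h) t \<otimes> k (inv\<^bsub>G\<^esub> t \<otimes>\<^bsub>G\<^esub> x)
          = (\<Oplus>u\<in>A. f u \<otimes> (h (inv\<^bsub>G\<^esub> u \<otimes>\<^bsub>G\<^esub> t) \<otimes> k (inv\<^bsub>G\<^esub> t \<otimes>\<^bsub>G\<^esub> x)))"
        using mult_RG[OF f h _ A, of t] f h k A(1)
        by (simp add: finsum_ldistr Pi_def m_assoc)
    qed (use f h k in \<open>auto intro!: finsum_closed\<close>)
    also have "\<dots> = (\<Oplus>u\<in>A. \<Oplus>t\<in>T. f u \<otimes> (h (inv\<^bsub>G\<^esub> u \<otimes>\<^bsub>G\<^esub> t) \<otimes> k (inv\<^bsub>G\<^esub> t \<otimes>\<^bsub>G\<^esub> x)))"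
      using f h k A T by (intro finsum_swap) auto
    also have "\<dots> = (\<Oplus>u\<in>A. f u \<otimes> (h \<otimes>\<^bsub>RG\<^esub> k) (inv\<^bsub>G\<^esub> u \<otimes>\<^bsub>G\<^esub> x))"
    proof (rule finsum_cong'[OF refl])
      fix u assume "u \<in> A"
      then show "(\<Oplus>t\<in>T. f u \<otimes> (h (inv\<^bsub>G\<^esub> u \<otimes>\<^bsub>G\<^esub> t) \<otimes> k (inv\<^bsub>G\<^esub> t \<otimes>\<^bsub>G\<^esub> x)))
          = f u \<otimes> (h \<otimes>\<^bsub>RG\<^esub> k) (inv\<^bsub>G\<^esub> u \<otimes>\<^bsub>G\<^esub> x)"
        using inner f h k T(1) by (simp add: finsum_rdistr[symmetric] Pi_def)
    qed (use f hk in auto)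
    also have "\<dots> = (f \<otimes>\<^bsub>RG\<^esub> (h \<otimes>\<^bsub>RG\<^esub> k)) x" using mult_RG[OF f hk x A] by simp
    finally show ?thesis .
  qed
qed

text \<open>This encodes the element \<open>r g\<close> of the group ring.\<close>

definition monomial :: "'r \<Rightarrow> 'g \<Rightarrow> 'g \<Rightarrow> 'r" where
  "monomial r g = (\<lambda>x. if x = g then r else \<zero>)"

lemma monomial_closed: "r \<in> carrier R \<Longrightarrow> g \<in> carrier G \<Longrightarrow> monomial r g \<in> carrier RG"
  unfolding carrier_RG monomial_def by (intro conjI exI[of _ "{g}"]) auto

lemma one_RG_monomial: "\<one>\<^bsub>RG\<^esub> = monomial \<one> \<one>\<^bsub>G\<^esub>"
  by (simp add: one_RG monomial_def)

lemma monomial_mult_RG: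
  assumes "r \<in> carrier R" "g \<in> carrier G" "h \<in> carrier RG" "x \<in> carrier G"
  shows "(monomial r g \<otimes>\<^bsub>RG\<^esub> h) x = r \<otimes> h (inv\<^bsub>G\<^esub> g \<otimes>\<^bsub>G\<^esub> x)"
proof -
  have "(monomial r g \<otimes>\<^bsub>RG\<^esub> h) x = (\<Oplus>u\<in>{g}. monomial r g u \<otimes> h (inv\<^bsub>G\<^esub> u \<otimes>\<^bsub>G\<^esub> x))"
    using assms(2) by (intro mult_RG[OF monomial_closed[OF assms(1,2)] assms(3,4)]) (auto simp: monomial_def)
  also have "\<dots> = r \<otimes> h (inv\<^bsub>G\<^esub> g \<otimes>\<^bsub>G\<^esub> x)"
    using assms by (simp add: monomial_def finsum_insert finsum_empty)
  finally show ?thesis .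
qed

lemma group_ring_is_ring: "ring RG"
proof (rule ringI)
  show "abelian_group RG"
  proof (rule abelian_groupI)
    fix f h assume f: "f \<in> carrier RG" and h: "h \<in> carrier RG"
    obtain A where A: "finite A" "A \<subseteq> carrier G" "\<And>u. u \<notin> A \<Longrightarrow> f u = \<zero>"
      using f by (auto simp: carrier_RG)
    obtain B where B: "finite B" "B \<subseteq> carrier G" "\<And>u. u \<notin> B \<Longrightarrow> h u = \<zero>"
      using h by (auto simp: carrier_RG)
    show "f \<oplus>\<^bsub>RG\<^esub> h \<in> carrier RG"
      unfolding carrier_RG add_RG using A B f h by (intro conjI exI[of _ "A \<union> B"]) auto
    show "f \<oplus>\<^bsub>RG\<^esub> h = h \<oplus>\<^bsub>RG\<^esub> f" using f h by (auto simp: add_RG a_comm)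
    have "(\<lambda>x. \<ominus> f x) \<in> carrier RG"
      unfolding carrier_RG using A f by (auto intro!: exI[of _ A])
    then show "\<exists>k\<in>carrier RG. k \<oplus>\<^bsub>RG\<^esub> f = \<zero>\<^bsub>RG\<^esub>"
      using f by (intro bexI[of _ "\<lambda>x. \<ominus> f x"]) (auto simp: add_RG zero_RG l_neg)
  qed (auto simp: add_RG zero_RG carrier_RG a_assoc)
next
  have one: "\<one>\<^bsub>RG\<^esub> \<in> carrier RG" by (simp add: one_RG_monomial monomial_closed)
  show "monoid RG"
  proof (rule monoidI)
    fix f assume f: "f \<in> carrier RG"
    show "\<one>\<^bsub>RG\<^esub> \<otimes>\<^bsub>RG\<^esub> f = f"
    proof
      fix x show "(\<one>\<^bsub>RG\<^esub> \<otimes>\<^bsub>RG\<^esub> f) x = f x"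
        using monomial_mult_RG[of \<one> "\<one>\<^bsub>G\<^esub>" f x] mult_RG_outside[OF one f, of x] RG_zero_outside[OF f, of x] f
        by (cases "x \<in> carrier G") (auto simp: one_RG_monomial)
    qed
    show "f \<otimes>\<^bsub>RG\<^esub> \<one>\<^bsub>RG\<^esub> = f"
    proof
      fix x
      obtain A where A: "finite A" "A \<subseteq> carrier G" "\<And>u. u \<notin> A \<Longrightarrow> f u = \<zero>"
        using f by (auto simp: carrier_RG)
      show "(f \<otimes>\<^bsub>RG\<^esub> \<one>\<^bsub>RG\<^esub>) x = f x"
      proof (cases "x \<in> carrier G")
        case False
        then show ?thesis using mult_RG_outside[OF f one] RG_zero_outside[OF f] by simp
      next
        case True
        \<comment> \<open>The index \<open>x\<close> is added so that the sum contains its only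
          possibly nonzero term even if \<open>x \<notin> A\<close>.\<close>
        have A': "finite (insert x A)" "insert x A \<subseteq> carrier G" "\<And>u. u \<notin> insert x A \<Longrightarrow> f u = \<zero>"
          using A True by auto
        have "(f \<otimes>\<^bsub>RG\<^esub> \<one>\<^bsub>RG\<^esub>) x = (\<Oplus>u\<in>insert x A. f u \<otimes> \<one>\<^bsub>RG\<^esub> (inv\<^bsub>G\<^esub> u \<otimes>\<^bsub>G\<^esub> x))"
          by (rule mult_RG[OF f one True A'])
        also have "\<dots> = (\<Oplus>u\<in>insert x A. if x = u then f u else \<zero>)"
        proof (rule finsum_cong'[OF refl])
          fix u assume "u \<in> insert x A"
          then have "u \<in> carrier G" using A' by auto
          then have "inv\<^bsub>G\<^esub> u \<otimes>\<^bsub>G\<^esub> x = \<one>\<^bsub>G\<^esub> \<longleftrightarrow> x = u"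
            using True by (metis G.inv_closed G.inv_solve_left G.l_inv G.r_one G.one_closed)
          then show "f u \<otimes> \<one>\<^bsub>RG\<^esub> (inv\<^bsub>G\<^esub> u \<otimes>\<^bsub>G\<^esub> x) = (if x = u then f u else \<zero>)"
            using f by (auto simp: one_RG)
        qed (use f in auto)
        also have "\<dots> = f x" using A'(1) f by (intro finsum_singleton) auto
        finally show ?thesis .
      qed
    qed
  qed (use mult_RG_closed mult_RG_assoc one in auto)
next
  fix f h k assume f: "f \<in> carrier RG" and h: "h \<in> carrier RG" and k: "k \<in> carrier RG"
  obtain A where A: "finite A" "A \<subseteq> carrier G" "\<And>u. u \<notin> A \<Longrightarrow> f u = \<zero>"
    using f by (auto simp: carrier_RG)
  obtain B where B: "finite B" "B \<subseteq> carrier G" "\<And>u. u \<notin> B \<Longrightarrow> h u = \<zero>"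
    using h by (auto simp: carrier_RG)
  obtain C where C: "finite C" "C \<subseteq> carrier G" "\<And>u. u \<notin> C \<Longrightarrow> k u = \<zero>"
    using k by (auto simp: carrier_RG)
  have fh: "f \<oplus>\<^bsub>RG\<^esub> h \<in> carrier RG"
    unfolding carrier_RG add_RG using A B f h by (intro conjI exI[of _ "A \<union> B"]) auto
  \<comment> \<open>One index set for all three products makes the identity hold term by
    term.\<close>
  have U: "finite (A \<union> B)" "A \<union> B \<subseteq> carrier G" using A B by auto
  show "(f \<oplus>\<^bsub>RG\<^esub> h) \<otimes>\<^bsub>RG\<^esub> k = f \<otimes>\<^bsub>RG\<^esub> k \<oplus>\<^bsub>RG\<^esub> h \<otimes>\<^bsub>RG\<^esub> k"
  proof
    fix x
    show "((f \<oplus>\<^bsub>RG\<^esub> h) \<otimes>\<^bsub>RG\<^esub> k) x = (f \<otimes>\<^bsub>RG\<^esub> k \<oplus>\<^bsub>RG\<^esub> h \<otimes>\<^bsub>RG\<^esub> k) x"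
    proof (cases "x \<in> carrier G")
      case False
      then show ?thesis
        using mult_RG_outside[OF fh k] mult_RG_outside[OF f k] mult_RG_outside[OF h k] by (simp add: add_RG)
    next
      case True
      have "((f \<oplus>\<^bsub>RG\<^esub> h) \<otimes>\<^bsub>RG\<^esub> k) x = (\<Oplus>u\<in>A \<union> B. (f \<oplus>\<^bsub>RG\<^esub> h) u \<otimes> k (inv\<^bsub>G\<^esub> u \<otimes>\<^bsub>G\<^esub> x))"
        using A B by (intro mult_RG[OF fh k True U]) (auto simp: add_RG)
      moreover have "(f \<otimes>\<^bsub>RG\<^esub> k) x = (\<Oplus>u\<in>A \<union> B. f u \<otimes> k (inv\<^bsub>G\<^esub> u \<otimes>\<^bsub>G\<^esub> x))"
        using A by (intro mult_RG[OF f k True U]) auto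
      moreover have "(h \<otimes>\<^bsub>RG\<^esub> k) x = (\<Oplus>u\<in>A \<union> B. h u \<otimes> k (inv\<^bsub>G\<^esub> u \<otimes>\<^bsub>G\<^esub> x))"
        using B by (intro mult_RG[OF h k True U]) auto
      ultimately show ?thesis using f h k
        by (simp add: add_RG Pi_def l_distr)
    qed
  qed
  show "k \<otimes>\<^bsub>RG\<^esub> (f \<oplus>\<^bsub>RG\<^esub> h) = k \<otimes>\<^bsub>RG\<^esub> f \<oplus>\<^bsub>RG\<^esub> k \<otimes>\<^bsub>RG\<^esub> h"
  proof
    fix x
    show "(k \<otimes>\<^bsub>RG\<^esub> (f \<oplus>\<^bsub>RG\<^esub> h)) x = (k \<otimes>\<^bsub>RG\<^esub> f \<oplus>\<^bsub>RG\<^esub> k \<otimes>\<^bsub>RG\<^esub> h) x"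
    proof (cases "x \<in> carrier G")
      case False
      then show ?thesis
        using mult_RG_outside[OF k fh] mult_RG_outside[OF k f] mult_RG_outside[OF k h] by (simp add: add_RG)
    next
      case True
      show ?thesis
        using mult_RG[OF k fh True C] mult_RG[OF k f True C] mult_RG[OF k h True C] f h k
        by (simp add: add_RG Pi_def r_distr)
    qed
  qed
qed

sublocale RG: ring RG by (rule group_ring_is_ring)

section \<open>Embedding the group and the units of the coefficient ring\<close>

lemma monomial_mult:
  assumes r: "r \<in> carrier R" "s \<in> carrier R" and g: "g \<in> carrier G" "h \<in> carrier G"
  shows "monomial r g \<otimes>\<^bsub>RG\<^esub> monomial s h = monomial (r \<otimes> s) (g \<otimes>\<^bsub>G\<^esub> h)"
proof
  fix x
  show "(monomial r g \<otimes>\<^bsub>RG\<^esub> monomial s h) x = monomial (r \<otimes> s) (g \<otimes>\<^bsub>G\<^esub> h) x"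
  proof (cases "x \<in> carrier G")
    case False
    then have "x \<noteq> g \<otimes>\<^bsub>G\<^esub> h" using g by auto
    then show ?thesis using False r g
      by (simp add: mult_RG_outside monomial_closed) (simp add: monomial_def)
  next
    case True
    have "inv\<^bsub>G\<^esub> g \<otimes>\<^bsub>G\<^esub> x = h \<longleftrightarrow> x = g \<otimes>\<^bsub>G\<^esub> h"
      using True g by (metis G.inv_solve_left)
    then show ?thesis using monomial_mult_RG[OF r(1) g(1) monomial_closed[OF r(2) g(2)] True] r
      by (auto simp: monomial_def)
  qed
qed

lemma monomial_Units:
  assumes u: "u \<in> Units R" and g: "g \<in> carrier G"
  shows "monomial u g \<in> Units RG"
  unfolding Units_def using u g
  by (auto intro!: monomial_closed bexI[of _ "monomial (inv u) (inv\<^bsub>G\<^esub> g)"]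
      simp: monomial_mult one_RG_monomial Units_closed)

lemma monomial_pow:
  assumes "r \<in> carrier R"
  shows "monomial r \<one>\<^bsub>G\<^esub> [^]\<^bsub>RG\<^esub> (n::nat) = monomial (r [^] n) \<one>\<^bsub>G\<^esub>"
  by (induction n) (use assms in \<open>simp_all add: one_RG_monomial monomial_mult\<close>)

text \<open>Evaluated at the identity coefficient of the one element, this passes the characteristic
  from \<open>RG\<close> down to \<open>R\<close>.\<close>

lemma add_pow_RG:
  assumes "f \<in> carrier RG"
  shows "([(n::nat)] \<cdot>\<^bsub>RG\<^esub> f) x = [n] \<cdot> (f x)"
  by (induction n) (use assms in \<open>simp_all add: zero_RG add_RG\<close>)

text \<open>The map \<open>monomial \<one>\<close> is a homomorphism from \<open>G\<close> to the
  units, injective because \<open>\<one> \<noteq> \<zero>\<close>, and finitely generated subgroups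
  have finite images under it.\<close>

lemma locally_finite_if_Units_torsion:
  assumes ln: "locally_nilpotent (units_of RG)"
    and tors: "\<And>u. u \<in> Units RG \<Longrightarrow> \<exists>n>0. u [^]\<^bsub>RG\<^esub> (n::nat) = \<one>\<^bsub>RG\<^esub>"
    and nontrivial: "\<one> \<noteq> \<zero>"
  shows "locally_finite G"
  unfolding locally_finite_def
proof (intro allI impI)
  fix A assume A: "finite A \<and> A \<subseteq> carrier G"
  let ?U = "units_of RG"
  interpret U: group ?U by (rule RG.units_group)
  have mU: "monomial \<one> g \<in> carrier ?U" if "g \<in> carrier G" for g
    using monomial_Units[of \<one> g] that by (simp add: units_of_carrier)
  interpret \<iota>: group_hom G ?U "monomial \<one>"
    by (intro group_hom.intro group_hom_axioms.intro G.is_group U.is_group homI)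
      (simp_all add: mU units_of_mult monomial_mult)
  have "finite (generate ?U (monomial \<one> ` A))"
  proof (rule U.finite_generate_if_locally_nilpotent[OF ln])
    show "monomial \<one> ` A \<subseteq> carrier ?U" using A mU by auto
    fix u assume "u \<in> monomial \<one> ` A"
    then have "u \<in> Units RG" using A mU by (auto simp: units_of_carrier)
    then show "\<exists>n>0. u [^]\<^bsub>?U\<^esub> (n::nat) = \<one>\<^bsub>?U\<^esub>"
      using tors by (simp add: RG.units_of_pow units_of_one)
  qed (use A in simp)
  then have "finite (monomial \<one> ` generate G A)" using \<iota>.generate_img A by simp
  moreover have "inj_on (monomial \<one>) B" for B
  proof (rule inj_onI)
    fix g h assume "monomial \<one> g = monomial \<one> h"
    then have "monomial \<one> g g = monomial \<one> h g" by simp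
    then show "g = h" using nontrivial by (auto simp: monomial_def split: if_splits)
  qed
  ultimately have "finite (generate G A)" using finite_imageD by blast
  then show "finite (carrier (subgroup_generated G A))"
    using A by (simp add: carrier_subgroup_generated Int_absorb1)
qed

lemma Units_torsion_if_Units_RG_torsion:
  assumes tors: "\<And>u. u \<in> Units RG \<Longrightarrow> \<exists>n>0. u [^]\<^bsub>RG\<^esub> (n::nat) = \<one>\<^bsub>RG\<^esub>" and u: "u \<in> Units R"
  shows "\<exists>n>0. u [^] (n::nat) = \<one>"
proof -
  obtain n :: nat where n: "n > 0" "monomial u \<one>\<^bsub>G\<^esub> [^]\<^bsub>RG\<^esub> n = \<one>\<^bsub>RG\<^esub>"
    using tors[OF monomial_Units[OF u G.one_closed]] by blast
  \<comment> \<open>Comparing coefficients at the group identity recovers the relation in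
    \<open>R\<close>.\<close>
  then have "monomial (u [^] n) \<one>\<^bsub>G\<^esub> \<one>\<^bsub>G\<^esub> = monomial \<one> \<one>\<^bsub>G\<^esub> \<one>\<^bsub>G\<^esub>"
    using u by (simp add: monomial_pow one_RG_monomial Units_closed)
  then show ?thesis using n(1) by (auto simp: monomial_def)
qed

end

section \<open>Local rings\<close>

context ring
begin

lemma left_ideal_one_imp_carrier:
  assumes "left_ideal I R" "\<one> \<in> I"
  shows "I = carrier R"
proof -
  interpret additive_subgroup I R using assms(1) by (simp add: left_ideal_def)
  show ?thesis using assms a_subset r_one unfolding left_ideal_def by (metis subsetI subset_antisym)
qed

text \<open>Zorn's lemma is applied to the left ideals above \<open>I\<close> that omit
  \<open>\<one>\<close>, a property inherited by unions of chains. A left ideal containing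
  \<open>\<one>\<close> is everything, so a maximal member is maximal among all proper left
  ideals.\<close>

lemma exists_maximal_left_ideal:
  assumes I: "left_ideal I R" "\<one> \<notin> I"
  shows "\<exists>M. maximal_left_ideal M R \<and> I \<subseteq> M"
proof -
  define \<A> where "\<A> = {J. left_ideal J R \<and> I \<subseteq> J \<and> \<one> \<notin> J}"
  have "\<exists>M\<in>\<A>. \<forall>J\<in>\<A>. M \<subseteq> J \<longrightarrow> J = M"
  proof (rule subset_Zorn_nonempty)
    show "\<A> \<noteq> {}" using I by (auto simp: \<A>_def)
    fix C assume C: "C \<noteq> {}" "subset.chain \<A> C"
    then have CA: "\<And>J. J \<in> C \<Longrightarrow> left_ideal J R \<and> I \<subseteq> J \<and> \<one> \<notin> J"
      by (auto simp: \<A>_def subset.chain_def)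
    have sub: "subgroup J (add_monoid R)" if "J \<in> C" for J
      using CA[OF that] by (simp add: left_ideal_def additive_subgroup_def)
    have "subgroup (\<Union>C) (add_monoid R)"
    proof (rule add.subgroupI)
      show "\<Union>C \<subseteq> carrier R" using subgroup.subset[OF sub] by auto
      show "\<Union>C \<noteq> {}" using C(1) subgroup.one_closed[OF sub] by fastforce
      show "\<ominus> a \<in> \<Union>C" if "a \<in> \<Union>C" for a
        using that subgroup.m_inv_closed[OF sub] by (auto simp: a_inv_def)
      fix a b assume "a \<in> \<Union>C" "b \<in> \<Union>C"
      then obtain J K where JK: "J \<in> C" "K \<in> C" "a \<in> J" "b \<in> K" by blast
      then have "J \<subseteq> K \<or> K \<subseteq> J" using C(2) by (auto simp: subset.chain_def)
      then show "a \<oplus> b \<in> \<Union>C"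
        using JK subgroup.m_closed[OF sub[OF JK(1)], of a b] subgroup.m_closed[OF sub[OF JK(2)], of a b]
        by auto
    qed
    then have "left_ideal (\<Union>C) R"
      using CA unfolding left_ideal_def additive_subgroup_def by blast
    then show "\<Union>C \<in> \<A>" using CA C(1) by (auto simp: \<A>_def)
  qed
  then obtain M where M: "M \<in> \<A>" "\<And>J. J \<in> \<A> \<Longrightarrow> M \<subseteq> J \<Longrightarrow> J = M" by blast
  then have "maximal_left_ideal M R"
    unfolding maximal_left_ideal_def \<A>_def using left_ideal_one_imp_carrier by blast
  then show ?thesis using M(1) by (auto simp: \<A>_def)
qed

lemma left_ideal_principal:
  assumes x: "x \<in> carrier R"
  shows "left_ideal ((\<lambda>r. r \<otimes> x) ` carrier R) R"
  unfolding left_ideal_def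
proof (intro conjI ballI)
  show "additive_subgroup ((\<lambda>r. r \<otimes> x) ` carrier R) R"
  proof (intro additive_subgroup.intro add.subgroupI)
    fix a assume "a \<in> (\<lambda>r. r \<otimes> x) ` carrier R"
    then show "\<ominus> a \<in> (\<lambda>r. r \<otimes> x) ` carrier R" using x by (auto simp: l_minus[symmetric])
  next
    fix a b assume "a \<in> (\<lambda>r. r \<otimes> x) ` carrier R" "b \<in> (\<lambda>r. r \<otimes> x) ` carrier R"
    then show "a \<oplus> b \<in> (\<lambda>r. r \<otimes> x) ` carrier R" using x by (auto simp: l_distr[symmetric])
  qed (use x in auto)
  fix r a assume "r \<in> carrier R" "a \<in> (\<lambda>r. r \<otimes> x) ` carrier R"
  then show "r \<otimes> a \<in> (\<lambda>r. r \<otimes> x) ` carrier R" using x by (auto simp: m_assoc[symmetric])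
qed

text \<open>Every element outside the unique maximal left ideal \<open>M\<close> is a unit, and
  \<open>x\<close> and \<open>\<one> \<ominus> x\<close> cannot both lie in \<open>M\<close>, as
  their sum is \<open>\<one>\<close>.\<close>

lemma local_ring_Units_or_one_minus_Units:
  assumes loc: "local_ring R" and x: "x \<in> carrier R"
  shows "x \<in> Units R \<or> \<one> \<ominus> x \<in> Units R"
proof -
  obtain M where M: "maximal_left_ideal M R" and uniq: "\<And>M'. maximal_left_ideal M' R \<Longrightarrow> M' = M"
    using loc unfolding local_ring_def by blast
  have lM: "left_ideal M R" using M by (simp add: maximal_left_ideal_def)
  interpret M: additive_subgroup M R using lM by (simp add: left_ideal_def)
  have oneM: "\<one> \<notin> M" using M left_ideal_one_imp_carrier by (auto simp: maximal_left_ideal_def)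
  \<comment> \<open>Without a left inverse, the left ideal generated by \<open>a\<close> would be
    proper and hence contained in \<open>M\<close>.\<close>
  have linv: "\<exists>b\<in>carrier R. b \<otimes> a = \<one>" if a: "a \<in> carrier R" "a \<notin> M" for a
  proof (rule ccontr)
    assume "\<not> ?thesis"
    then have "\<one> \<notin> (\<lambda>r. r \<otimes> a) ` carrier R" by force
    then have "(\<lambda>r. r \<otimes> a) ` carrier R \<subseteq> M"
      using exists_maximal_left_ideal[OF left_ideal_principal[OF a(1)]] uniq by blast
    moreover have "\<one> \<otimes> a \<in> (\<lambda>r. r \<otimes> a) ` carrier R" by blast
    ultimately show False using a by auto
  qed
  have one_minus: "\<one> \<ominus> a \<notin> M" if "a \<in> M" for a
  proof
    assume "\<one> \<ominus> a \<in> M"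
    then have "(\<one> \<ominus> a) \<oplus> a \<in> M" using that by simp
    moreover have "(\<one> \<ominus> a) \<oplus> a = \<one>" using M.a_Hcarr[OF that] by algebra
    ultimately show False using oneM by simp
  qed
  have unit: "a \<in> Units R" if a: "a \<in> carrier R" "a \<notin> M" for a
  proof -
    obtain b where b: "b \<in> carrier R" "b \<otimes> a = \<one>" using linv[OF a] by blast
    \<comment> \<open>Otherwise \<open>\<one> \<ominus> a \<otimes> b\<close> has a left inverse,
      yet it annihilates \<open>a\<close> because \<open>b \<otimes> a = \<one>\<close>; this forces
      \<open>a = \<zero>\<close>, which lies in \<open>M\<close>.\<close>
    have "b \<notin> M"
    proof
      assume "b \<in> M"
      then have ab: "a \<otimes> b \<in> M" using lM a by (simp add: left_ideal_def)
      then obtain c where c: "c \<in> carrier R" "c \<otimes> (\<one> \<ominus> a \<otimes> b) = \<one>"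
        using linv[OF _ one_minus[OF ab]] a b by auto
      have "(\<one> \<ominus> a \<otimes> b) \<otimes> a = a \<ominus> a \<otimes> (b \<otimes> a)" using a(1) b(1) by algebra
      also have "\<dots> = \<zero>" unfolding b(2) using a(1) r_one[OF a(1)] by (simp add: minus_eq r_neg)
      finally have "(\<one> \<ominus> a \<otimes> b) \<otimes> a = \<zero>" .
      then have "c \<otimes> (\<one> \<ominus> a \<otimes> b) \<otimes> a = \<zero>" using c(1) a(1) b(1) by (simp add: m_assoc)
      then have "a = \<zero>" using c(2) a(1) by simp
      then show False using a(2) M.zero_closed by simp
    qed
    then obtain c where c: "c \<in> carrier R" "c \<otimes> b = \<one>" using linv[OF b(1)] by blast
    \<comment> \<open>The left inverse \<open>c\<close> of \<open>b\<close> and its right inverse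
      \<open>a\<close> coincide, so \<open>b\<close> is a two-sided inverse of
      \<open>a\<close>.\<close>
    have "c = a" using a(1) b c by (metis m_assoc l_one r_one)
    then show ?thesis unfolding Units_def using a(1) b c by blast
  qed
  show ?thesis
    using unit[OF x] unit[of "\<one> \<ominus> x"] one_minus[of x] x by auto
qed

text \<open>If \<open>\<one> = \<zero>\<close>, every left ideal contains \<open>\<one>\<close>, so
  none is proper and none can be maximal.\<close>

lemma one_not_zero_if_local:
  assumes "local_ring R"
  shows "\<one> \<noteq> \<zero>"
proof
  assume eq: "\<one> = \<zero>"
  obtain M where M: "left_ideal M R" "M \<noteq> carrier R"
    using assms by (auto simp: local_ring_def maximal_left_ideal_def)
  interpret M: additive_subgroup M R using M(1) by (simp add: left_ideal_def)
  show False using left_ideal_one_imp_carrier[OF M(1)] M(2) M.zero_closed eq by simp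
qed

end

theorem theorem3p6:
  fixes R :: "('r, 'm) ring_scheme" and G :: "('g, 'n) monoid_scheme"
  assumes "local_ring R" and "group G"
    and "locally_nilpotent (units_of (group_ring R G))"
    and "semi_nil_clean (group_ring R G)"
  shows "periodic_ring R \<and> locally_finite G"
proof
  interpret ring_and_group R G
    using assms(1,2) by (simp add: ring_and_group_def local_ring_def)
  have tors: "\<exists>n>0. u [^]\<^bsub>RG\<^esub> (n::nat) = \<one>\<^bsub>RG\<^esub>" if "u \<in> Units RG" for u
    using RG.Units_torsion_if_semi_nil_clean[OF assms(4,3) that] .
  show "locally_finite G"
    using locally_finite_if_Units_torsion[OF assms(3) tors] one_not_zero_if_local[OF assms(1)] by blast
  obtain N :: nat where N: "N > 0" "[N] \<cdot>\<^bsub>RG\<^esub> \<one>\<^bsub>RG\<^esub> = \<zero>\<^bsub>RG\<^esub>"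
    using RG.positive_char_if_semi_nil_clean[OF assms(4)] by blast
  have char: "[N] \<cdot>\<^bsub>R\<^esub> \<one>\<^bsub>R\<^esub> = \<zero>\<^bsub>R\<^esub>"
    using add_pow_RG[OF RG.one_closed, of N "\<one>\<^bsub>G\<^esub>"] N(2) by (simp add: zero_RG one_RG)
  have unit: "periodic_elem R u" if u: "u \<in> Units R" for u
    using Units_torsion_if_Units_RG_torsion[OF tors u] periodic_if_torsion u by blast
  show "periodic_ring R"
    unfolding periodic_ring_def
  proof
    fix x assume x: "x \<in> carrier R"
    consider "x \<in> Units R" | "\<one>\<^bsub>R\<^esub> \<ominus>\<^bsub>R\<^esub> x \<in> Units R"
      using local_ring_Units_or_one_minus_Units[OF assms(1) x] by blast
    then show "periodic_elem R x"
    proof cases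
      case 2
      \<comment> \<open>The unit \<open>1 - x\<close> is periodic, and subtracting it from one,
        which preserves periodicity, gives back \<open>x\<close>.\<close>
      have "\<one>\<^bsub>R\<^esub> \<ominus>\<^bsub>R\<^esub> (\<one>\<^bsub>R\<^esub> \<ominus>\<^bsub>R\<^esub> x) = x" using x by algebra
      then show ?thesis using periodic_one_minus[OF N(1) char _ unit[OF 2]] x by simp
    qed (rule unit)
  qed
qed

end
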